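(* Let $\mathcal{Z}=[0,1]^d$, $d>1$. Let $P_{\mathbb{N}}\in\mathcal{M}(\mathcal{Z}^{\mathbb{N}})$ be a probability measure such that the coordinate process $(Z_i)_{i\in\mathbb{N}}$, $Z_i:\mathcal{Z}^{\mathbb{N}}\to\mathcal{Z}$, is strongly (strictly) stationary and $\alpha$-mixing with $$\sum_{m=0}^{\infty}(m+1)^{8d+7}\Big(\alpha\big(\sigma(Z_1,\dots,Z_i),\sigma(Z_{i+m},Z_{i+m+1},\dots),P_{\mathbb{N}}\big)\Big)^{1/2}<\infty,\quad i\in\mathbb{N}. \qquad ( * )$$ Assume that $Z_i$ has continuous marginal distributions for all $i\in\mathbb{N}$. Let $\mathcal{P}\subset\mathcal{M}(\mathcal{Z}^{\mathbb{N}})$ be the set of probability measures under which the coordinate process is strongly stationary and $\alpha$-mixing as in $( * )$ (with that measure in place of $P_{\mathbb{N}}$). Let $H$ be a Polish space with metric $d_H$, let $(S_n)_{n\in\mathbb{N}}$ be a sequence of estimators such that each $S_n:\mathcal{Z}^n\to H$ is continuous, and assume that $(S_n)$ is represented by a statistical operator $S:\mathcal{M}(\mathcal{Z})\to H$, i.e. $S_n(z_1,\dots,z_n)=S\big(\frac1n\sum_{i=1}^n\delta_{z_i}\big)$ for all $n\in\mathbb{N}$ and $(z_1,\dots,z_n)\in\mathcal{Z}^n$, where $S$ is uniformly continuous with respect to $d_{\mathrm{BL}}$. Let the bootstrap approximations, for $P_{\mathbb{N}}$ and for every $Q_{\mathbb{N}}\in\mathcal{P}$, be those of the moving block bootstrap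 with integer block lengths $b(n)$ and numbers of blocks $\ell(n)$ satisfying $b(n)=O(n^{1/2-a})$ for some $a>0$ and $\ell(n)\,b(n)=n$ (with the truncation convention for the last block when $b(n)$ does not divide $n$). Then the sequence of bootstrap approximations $(\mathcal{L}_{P_n^*}(S_n))_{n\in\mathbb{N}}$ is qualitatively robust at $P_{\mathbb{N}}$ with respect to $\mathcal{P}$; that is, for every $\varepsilon>0$ there are $\delta>0$ and $n_0\in\mathbb{N}$ such that for every $n\ge n_0$ and every $Q_{\mathbb{N}}\in\mathcal{P}$, $$d_{\mathrm{BL}}(P_n,Q_n)<\delta\ \Rightarrow\ d_{\mathrm{BL}}\big(\mathcal{L}(\mathcal{L}_{P_n^*}(S_n)),\mathcal{L}(\mathcal{L}_{Q_n^*}(S_n))\big)<\varepsilon .$$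
   Context: All topological spaces carry their Borel $\sigma$-algebras. $\mathcal{M}(\mathcal{X})$ denotes the set of Borel probability measures on $\mathcal{X}$; for a Polish space $\mathcal{X}$, $\mathcal{M}(\mathcal{X})$ with the weak topology is Polish. $\mathcal{Z}=[0,1]^d$ carries its usual metric $d_{\mathcal{Z}}$. $\mathcal{M}(\mathcal{Z}^{\mathbb{N}})$ is the set of probability measures on $\mathcal{Z}^{\mathbb{N}}$ with the product $\sigma$-algebra. The coordinate process is $Z_i:\mathcal{Z}^{\mathbb{N}}\to\mathcal{Z}$, $(z_j)_{j\in\mathbb{N}}\mapsto z_i$. For $P_{\mathbb{N}}\in\mathcal{M}(\mathcal{Z}^{\mathbb{N}})$, $P_n$ denotes the law of $(Z_1,\dots,Z_n)$ under $P_{\mathbb{N}}$ (similarly $Q_n$ for $Q_{\mathbb{N}}$). "Continuous marginal distributions" means that the distribution functions of the $d$ real components of $Z_i$ are continuous. Mixing coefficient: for $\sigma$-algebras $\mathcal{A}_1,\mathcal{A}_2$ and a probability measure $\mu$, $\alpha(\mathcal{A}_1,\mathcal{A}_2,\mu)=\sup\{|\mu(A_1\cap A_2)-\mu(A_1)\mu(A_2)|: A_1\in\mathcal{A}_1,A_2\in\mathcal{A}_2\}$. A process $(Z_i)$ is $\alpha$-mixing with respect to $\mu$ if $\lim_{n\to\infty}\sup_{i\ge1}\alpha(\sigma(Z_i),\sigma(Z_{i+n}),\mu)=0$. Bounded Lipschitz metric: for a separable metric space $(\mathcal{X},d)$ and $\mu,\nu\in\mathcal{M}(\mathcal{X})$,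 $d_{\mathrm{BL}}(\mu,\nu)=\sup\{|\int f\,d\mu-\int f\,d\nu| : f:\mathcal{X}\to\mathbb{R},\ \|f\|_{\mathrm{BL}}\le 1\}$, where $\|f\|_{\mathrm{BL}}=\sup_{x\ne y}\frac{|f(x)-f(y)|}{d(x,y)}+\sup_x|f(x)|$. On $\mathcal{M}(\mathcal{Z}^n)$ it is formed with respect to the metric $d_n\big((z_1,\dots,z_n),(z_1',\dots,z_n')\big)=\inf\{\varepsilon>0:\ \sharp\{i: d_{\mathcal{Z}}(z_i,z_i')\ge\varepsilon\}/n\le\varepsilon\}$ on $\mathcal{Z}^n$ (which induces the product topology). On $\mathcal{M}(\mathcal{M}(H))$ it is formed with respect to the metric $d_{\mathrm{BL}}$ on $\mathcal{M}(H)$. Continuity of $S_n$ is with respect to the product topology on $\mathcal{Z}^n$. Moving block bootstrap: let $(Z_1,\dots,Z_n)\sim P_n$, let $b=b(n)<n$ be the block length and $\ell=\ell(n)$ the number of blocks. Put $Z_{n+j}=Z_j$ (circular extension) and form the blocks $B_{i,b}=(Z_i,\dots,Z_{i+b-1})$, $i=1,\dots,n$. Draw $I_1,\dots,I_\ell$ independently and uniformly with replacement from $\{1,\dots,n\}$, independently of $(Z_1,\dots,Z_n)$. The bootstrap sample $(Z_1^*,\dots,Z_n^* )$ is the concatenation of $B_{I_1,b},\dots,B_{I_\ell,b}$, of length $\ell b=n$; if $n$ is not a multiple of $b$, one uses $\ell=\lceil n/b\rceil$ blocks and cuts the last block so that the total length is $n$. The bootstrap approximation of $P_n$ is the random probability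 measure $P_n^*=\bigotimes_{i=1}^n\big(\frac1n\sum_{j=1}^n\delta_{Z_j^*}\big)$ on $\mathcal{Z}^n$. $\mathcal{L}_{P_n^*}(S_n)$ denotes the image measure of $P_n^*$ under $S_n$; it is a random element of $\mathcal{M}(H)$, and $\mathcal{L}(\mathcal{L}_{P_n^*}(S_n))\in\mathcal{M}(\mathcal{M}(H))$ is its distribution. $Q_n^*$ and $\mathcal{L}(\mathcal{L}_{Q_n^*}(S_n))$ are defined in the same way starting from $Q_n$, with the same $b(n),\ell(n)$. *)

theory Defs
  imports "HOL-Probability.Probability" "HOL-Library.Landau_Symbols"
begin

definition prob_measures :: "'a measure \<Rightarrow> 'a measure set" where
  "prob_measures N = {\<mu>. sets \<mu> = sets N \<and> prob_space \<mu>}"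

subsection \<open>The bounded Lipschitz metric\<close>

text \<open>The metric space is a carrier \<open>X\<close> with an explicit distance function \<open>d\<close>.  The norm is
  valued in \<^typ>\<open>ennreal\<close>: it may be infinite, and suprema over the empty set are 0.\<close>

definition bl_norm :: "'a set \<Rightarrow> ('a \<Rightarrow> 'a \<Rightarrow> real) \<Rightarrow> ('a \<Rightarrow> real) \<Rightarrow> ennreal" where
  "bl_norm X d f =
     (SUP (x, y) \<in> {(x, y). x \<in> X \<and> y \<in> X \<and> x \<noteq> y}. ennreal (\<bar>f x - f y\<bar> / d x y))
     + (SUP x \<in> X. ennreal \<bar>f x\<bar>)"

definition dBL :: "'a set \<Rightarrow> ('a \<Rightarrow> 'a \<Rightarrow> real) \<Rightarrow> 'a measure \<Rightarrow> 'a measure \<Rightarrow> real" where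
  "dBL X d \<mu> \<nu> =
     (SUP f \<in> {f. bl_norm X d f \<le> 1}. \<bar>(\<integral>x. f x \<partial>\<mu>) - (\<integral>x. f x \<partial>\<nu>)\<bar>)"

subsection \<open>The weak topology and its Borel sets\<close>

definition weak_topology :: "'h::topological_space measure topology" where
  "weak_topology = topology_generated_by
     {{\<mu> \<in> prob_measures borel. (\<integral>x. f x \<partial>\<mu>) \<in> U} | (f :: 'h \<Rightarrow> real) U.
        continuous_on UNIV f \<and> bounded (range f) \<and> open U}"

definition borel_of :: "'a topology \<Rightarrow> 'a measure" where
  "borel_of T = sigma (topspace T) {U. openin T U}"

subsection \<open>Sequences in the unit cube\<close>

definition unit_cube :: "(real ^ 'd) set" where
  "unit_cube = {z. \<forall>k. 0 \<le> z $ k \<and> z $ k \<le> 1}"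

definition cubeM :: "(real ^ 'd) measure" where
  "cubeM = restrict_space borel unit_cube"

text \<open>Sequences and tuples are indexed from 1: a point of \<open>\<Z>\<^sup>\<nat>\<close> is an extensional
  function on \<open>{1..}\<close>, a point of \<open>\<Z>\<^sup>n\<close> an extensional function on \<open>{1..n}\<close>.\<close>

abbreviation seqM :: "(nat \<Rightarrow> real ^ 'd) measure" where
  "seqM \<equiv> PiM {1..} (\<lambda>_. cubeM)"

abbreviation tupleM :: "nat \<Rightarrow> (nat \<Rightarrow> real ^ 'd) measure" where
  "tupleM n \<equiv> PiM {1..n} (\<lambda>_. cubeM)"

abbreviation tuples :: "nat \<Rightarrow> (nat \<Rightarrow> real ^ 'd) set" where
  "tuples n \<equiv> {1..n} \<rightarrow>\<^sub>E unit_cube"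

definition fin_law :: "(nat \<Rightarrow> real ^ 'd) measure \<Rightarrow> nat \<Rightarrow> (nat \<Rightarrow> real ^ 'd) measure" where
  "fin_law P n = distr P (tupleM n) (\<lambda>\<omega>. restrict \<omega> {1..n})"

definition tuple_dist :: "nat \<Rightarrow> (nat \<Rightarrow> real ^ 'd) \<Rightarrow> (nat \<Rightarrow> real ^ 'd) \<Rightarrow> real" where
  "tuple_dist n z z' =
     Inf {\<epsilon>. \<epsilon> > 0 \<and> real (card {i \<in> {1..n}. dist (z i) (z' i) \<ge> \<epsilon>}) / real n \<le> \<epsilon>}"

subsection \<open>Stationarity and mixing of the coordinate process\<close>

definition stationary :: "(nat \<Rightarrow> real ^ 'd) measure \<Rightarrow> bool" where
  "stationary P \<longleftrightarrow>
     (\<forall>J k. finite J \<and> J \<subseteq> {1..} \<longrightarrow>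
        distr P (PiM J (\<lambda>_. cubeM)) (\<lambda>\<omega>. \<lambda>j\<in>J. \<omega> (j + k))
        = distr P (PiM J (\<lambda>_. cubeM)) (\<lambda>\<omega>. \<lambda>j\<in>J. \<omega> j))"

text \<open>\<open>coord_sigma J\<close> is the \<open>\<sigma>\<close>-algebra \<open>\<sigma>(Z\<^sub>j : j \<in> J)\<close> on the sequence space.\<close>

definition coord_sigma :: "nat set \<Rightarrow> (nat \<Rightarrow> real ^ 'd) set set" where
  "coord_sigma J = sigma_sets (space seqM)
     {(\<lambda>\<omega>. \<omega> j) -` A \<inter> space seqM | j A. j \<in> J \<and> A \<in> sets cubeM}"

definition alpha_coeff :: "'a set set \<Rightarrow> 'a set set \<Rightarrow> 'a measure \<Rightarrow> real" where
  "alpha_coeff \<A> \<B> \<mu> =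
     (SUP (A, B) \<in> \<A> \<times> \<B>. \<bar>measure \<mu> (A \<inter> B) - measure \<mu> A * measure \<mu> B\<bar>)"

definition alpha_mixing :: "(nat \<Rightarrow> real ^ 'd) measure \<Rightarrow> bool" where
  "alpha_mixing P \<longleftrightarrow>
     (\<lambda>n. SUP i \<in> {1..}. alpha_coeff (coord_sigma {i}) (coord_sigma {i + n}) P) \<longlonglongrightarrow> 0"

definition mixing_rate :: "(nat \<Rightarrow> real ^ 'd) measure \<Rightarrow> bool" where
  "mixing_rate P \<longleftrightarrow>
     (\<forall>i\<ge>1. summable (\<lambda>m. real (m + 1) ^ (8 * CARD('d) + 7)
        * sqrt (alpha_coeff (coord_sigma {1..i}) (coord_sigma {i + m..}) P)))"

definition mixing_class :: "(nat \<Rightarrow> real ^ 'd) measure set" where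
  "mixing_class =
     {P \<in> prob_measures seqM. stationary P \<and> alpha_mixing P \<and> mixing_rate P}"

definition continuous_marginals :: "(nat \<Rightarrow> real ^ 'd) measure \<Rightarrow> bool" where
  "continuous_marginals P \<longleftrightarrow>
     (\<forall>i\<ge>1. \<forall>k. continuous_on UNIV (cdf (distr P borel (\<lambda>\<omega>. \<omega> i $ k))))"

subsection \<open>Empirical measures and the moving block bootstrap\<close>

definition empirical :: "nat \<Rightarrow> (nat \<Rightarrow> real ^ 'd) \<Rightarrow> (real ^ 'd) measure" where
  "empirical n z = measure_of (space cubeM) (sets cubeM)
     (\<lambda>A. (\<Sum>i = 1..n. emeasure (return cubeM (z i)) A) / of_nat n)"

text \<open>Circular extension \<open>Z\<^bsub>n+j\<^esub> = Z\<^sub>j\<close>, for arguments \<open>j \<ge> 1\<close>.\<close>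

definition circular :: "nat \<Rightarrow> (nat \<Rightarrow> 'a) \<Rightarrow> nat \<Rightarrow> 'a" where
  "circular n z j = z ((j - 1) mod n + 1)"

definition block :: "nat \<Rightarrow> nat \<Rightarrow> (nat \<Rightarrow> 'a) \<Rightarrow> nat \<Rightarrow> 'a list" where
  "block n b z i = map (circular n z) [i..<i + b]"

text \<open>Truncating the concatenation to length \<open>n\<close> cuts the last block when \<open>b\<close> does not
  divide \<open>n\<close> and \<open>l\<close> is \<open>n / b\<close> rounded up.\<close>

definition boot_sample ::
  "nat \<Rightarrow> nat \<Rightarrow> nat \<Rightarrow> (nat \<Rightarrow> 'a) \<Rightarrow> (nat \<Rightarrow> nat) \<Rightarrow> nat \<Rightarrow> 'a" where
  "boot_sample n b l z I =
     (\<lambda>t\<in>{1..n}. take n (concat (map (\<lambda>k. block n b z (I k)) [1..<l + 1])) ! (t - 1))"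

definition boot_draws :: "nat \<Rightarrow> nat \<Rightarrow> (nat \<Rightarrow> nat) measure" where
  "boot_draws n l = PiM {1..l} (\<lambda>_. uniform_count_measure {1..n})"

definition boot_approx :: "nat \<Rightarrow> (nat \<Rightarrow> real ^ 'd) \<Rightarrow> (nat \<Rightarrow> real ^ 'd) measure" where
  "boot_approx n zs = PiM {1..n} (\<lambda>_. empirical n zs)"

definition boot_law ::
  "(nat \<Rightarrow> real ^ 'd) measure \<Rightarrow> nat \<Rightarrow> nat \<Rightarrow> nat \<Rightarrow>
   ((nat \<Rightarrow> real ^ 'd) \<Rightarrow> 'h::topological_space) \<Rightarrow> 'h measure measure" where
  "boot_law P n b l T =
     distr (fin_law P n \<Otimes>\<^sub>M boot_draws n l) (borel_of weak_topology)
       (\<lambda>(z, I). distr (boot_approx n (boot_sample n b l z I)) borel T)"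

end

theory Submission
  imports Defs
begin

text \<open>
The moving block bootstrap depends on the data in a uniformly continuous way, in the following
averaged sense.  A bootstrap sample is obtained from the data \<open>z\<close> by a random reindexing, and
because of the circular extension each single index is uniform on \<open>{1..n}\<close>.  The same is true of
the \<open>n\<close> independent draws from the empirical measure of the bootstrap sample that make up the
bootstrap approximation.  Reindexing two data sets \<open>z\<close>, \<open>z'\<close> by the same random indices therefore
leaves the mean coordinate distance \<open>(1/n) \<Sum>\<^sub>i dist (z i) (z' i)\<close> unchanged in expectation
(\<open>expected_mean_dist_reindex\<close>).  This distance bounds the bounded Lipschitz distance of the
empirical measures, and up to a constant it is bounded by the metric \<open>tuple_dist\<close>
(\<open>dBL_empirical_le_mean_dist\<close>, \<open>mean_dist_le_tuple_dist\<close>).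

Since the statistical operator \<open>S\<close> is uniformly continuous, Markov's inequality, in the form of the
pointwise bound in \<open>dBL_plug_in_law_le\<close>, shows that the laws of the statistic under the bootstrap
approximations of \<open>z\<close> and \<open>z'\<close>, built with the same blocks, are on average within
\<open>\<epsilon> + C * tuple_dist n z z'\<close>, where \<open>C\<close> depends on \<open>\<epsilon>\<close>, on \<open>S\<close> and on the dimension, but not on
\<open>n\<close>.  A test function on the space of laws, averaged over the blocks, thus becomes a function of
the data that is Lipschitz up to \<open>\<epsilon>\<close> with a constant independent of \<open>n\<close>.  An inf-convolution
(\<open>almost_Lipschitz_approx\<close>) makes it Lipschitz, and the assumed closeness of the two data laws
then bounds the difference of the two integrals; this is \<open>dBL_boot_law_le\<close>.

The remaining work concerns measurability: the bootstrap approximation depends continuously on the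
data in the weak topology (\<open>continuous_map_plug_in_law\<close>), and \<open>dBL\<close> separates probability measures
(\<open>dBL_eq_0_imp_eq\<close>), so that test functions on the space of laws are Lipschitz.
\<close>

section \<open>The bounded Lipschitz metric\<close>

text \<open>The Bochner integral of a function that is not integrable is 0, so the bound holds for every
  function.  It is applied to arbitrary test functions of the bounded Lipschitz metric.\<close>

lemma (in prob_space) abs_integral_le_bound:
  fixes f :: "'a \<Rightarrow> real"
  assumes "\<And>x. x \<in> space M \<Longrightarrow> \<bar>f x\<bar> \<le> c" and "0 \<le> c"
  shows "\<bar>\<integral>x. f x \<partial>M\<bar> \<le> c"
proof (cases "integrable M f")
  case True
  have "\<bar>\<integral>x. f x \<partial>M\<bar> \<le> (\<integral>x. \<bar>f x\<bar> \<partial>M)"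
    by (rule integral_abs_bound)
  also have "\<dots> \<le> (\<integral>x. c \<partial>M)"
    using True assms by (intro integral_mono) auto
  finally show ?thesis
    by (simp add: prob_space)
qed (simp add: not_integrable_integral_eq assms(2))

lemma bl_norm_leI:
  assumes "\<And>x y. x \<in> X \<Longrightarrow> y \<in> X \<Longrightarrow> x \<noteq> y \<Longrightarrow> \<bar>f x - f y\<bar> / d x y \<le> L"
    and "\<And>x. x \<in> X \<Longrightarrow> \<bar>f x\<bar> \<le> B"
    and "0 \<le> L" "0 \<le> B" "L + B \<le> 1"
  shows "bl_norm X d f \<le> 1"
proof -
  have "bl_norm X d f \<le> ennreal L + ennreal B"
    unfolding bl_norm_def using assms by (intro add_mono SUP_least) (auto intro!: ennreal_leI)
  also have "\<dots> = ennreal (L + B)"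
    using assms by (simp add: ennreal_plus)
  also have "\<dots> \<le> 1"
    using assms by (simp add: ennreal_le_1 del: ennreal_plus)
  finally show ?thesis .
qed

lemma bl_norm_imp_bounded:
  assumes "bl_norm X d f \<le> 1" "x \<in> X"
  shows "\<bar>f x\<bar> \<le> 1"
proof -
  have "ennreal \<bar>f x\<bar> \<le> (SUP x \<in> X. ennreal \<bar>f x\<bar>)"
    using assms by (intro SUP_upper) auto
  also have "\<dots> \<le> bl_norm X d f"
    unfolding bl_norm_def by simp
  also note assms(1)
  finally have "ennreal \<bar>f x\<bar> \<le> 1" .
  then show ?thesis
    by (simp add: ennreal_le_1)
qed

lemma bl_norm_imp_quotient_le:
  assumes "bl_norm X d f \<le> 1" "x \<in> X" "y \<in> X" "x \<noteq> y"
  shows "\<bar>f x - f y\<bar> / d x y \<le> 1"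
proof -
  let ?S = "{(x, y). x \<in> X \<and> y \<in> X \<and> x \<noteq> y}"
  have "(case (x, y) of (x, y) \<Rightarrow> ennreal (\<bar>f x - f y\<bar> / d x y))
      \<le> (SUP (x, y) \<in> ?S. ennreal (\<bar>f x - f y\<bar> / d x y))"
    using assms by (intro SUP_upper) auto
  also have "\<dots> \<le> bl_norm X d f"
    unfolding bl_norm_def by simp
  also note assms(1)
  finally have "ennreal (\<bar>f x - f y\<bar> / d x y) \<le> 1"
    by simp
  then show ?thesis
    by (simp add: ennreal_le_1)
qed

lemma bl_norm_imp_Lipschitz:
  fixes f :: "'a :: metric_space \<Rightarrow> real"
  assumes "bl_norm X dist f \<le> 1" "x \<in> X" "y \<in> X"
  shows "\<bar>f x - f y\<bar> \<le> dist x y"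
proof (cases "x = y")
  case False
  then show ?thesis
    using bl_norm_imp_quotient_le[OF assms] by (simp add: divide_le_eq)
qed simp

lemma bl_norm_imp_continuous_on:
  fixes f :: "'a :: metric_space \<Rightarrow> real"
  assumes "bl_norm X dist f \<le> 1"
  shows "continuous_on X f"
  unfolding continuous_on_iff
  using bl_norm_imp_Lipschitz[OF assms] by (metis dist_real_def le_less_trans)

lemma dBL_leI:
  assumes "\<And>f. bl_norm X d f \<le> 1 \<Longrightarrow> \<bar>(\<integral>x. f x \<partial>\<mu>) - (\<integral>x. f x \<partial>\<nu>)\<bar> \<le> c"
  shows "dBL X d \<mu> \<nu> \<le> c"
proof -
  have "bl_norm X d (\<lambda>_. 0) \<le> 1"
    by (rule bl_norm_leI[where L = 0 and B = 0]) auto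
  then show ?thesis
    unfolding dBL_def using assms by (intro cSUP_least) auto
qed

lemma abs_integral_diff_le_dBL:
  assumes "prob_space \<mu>" "prob_space \<nu>" "space \<mu> = X" "space \<nu> = X" "bl_norm X d f \<le> 1"
  shows "\<bar>(\<integral>x. f x \<partial>\<mu>) - (\<integral>x. f x \<partial>\<nu>)\<bar> \<le> dBL X d \<mu> \<nu>"
  unfolding dBL_def
proof (rule cSUP_upper)
  show "bdd_above ((\<lambda>f. \<bar>(\<integral>x. f x \<partial>\<mu>) - (\<integral>x. f x \<partial>\<nu>)\<bar>) ` {f. bl_norm X d f \<le> 1})"
  proof (rule bdd_aboveI2)
    fix f assume f: "f \<in> {f. bl_norm X d f \<le> 1}"
    have "\<bar>\<integral>x. f x \<partial>\<mu>\<bar> \<le> 1" "\<bar>\<integral>x. f x \<partial>\<nu>\<bar> \<le> 1"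
      using f assms bl_norm_imp_bounded[of X d f]
      by (auto intro!: prob_space.abs_integral_le_bound)
    then show "\<bar>(\<integral>x. f x \<partial>\<mu>) - (\<integral>x. f x \<partial>\<nu>)\<bar> \<le> 2"
      by linarith
  qed
qed (use assms in simp)

text \<open>Division by \<open>L + B\<close> turns \<open>f\<close> into a test function.\<close>

lemma abs_integral_diff_le_scaled_dBL:
  assumes "prob_space \<mu>" "prob_space \<nu>" "space \<mu> = X" "space \<nu> = X"
    and Lip: "\<And>x y. x \<in> X \<Longrightarrow> y \<in> X \<Longrightarrow> \<bar>f x - f y\<bar> \<le> L * d x y"
    and bound: "\<And>x. x \<in> X \<Longrightarrow> \<bar>f x\<bar> \<le> B"
    and nonneg: "\<And>x y. x \<in> X \<Longrightarrow> y \<in> X \<Longrightarrow> 0 \<le> d x y"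
    and "0 \<le> L" "0 < B"
  shows "\<bar>(\<integral>x. f x \<partial>\<mu>) - (\<integral>x. f x \<partial>\<nu>)\<bar> \<le> (L + B) * dBL X d \<mu> \<nu>"
proof -
  have pos: "0 < L + B"
    using assms by simp
  have "bl_norm X d (\<lambda>x. f x / (L + B)) \<le> 1"
  proof (rule bl_norm_leI[where L = "L / (L + B)" and B = "B / (L + B)"])
    fix x y assume xy: "x \<in> X" "y \<in> X"
    \<comment> \<open>If \<open>d x y = 0\<close>, the quotient is 0 by convention.\<close>
    have "\<bar>f x - f y\<bar> / d x y \<le> L"
    proof (cases "d x y = 0")
      case False
      then have "0 < d x y"
        using nonneg[OF xy] by simp
      then show ?thesis
        using Lip[OF xy] by (simp add: divide_le_eq)
    qed (use \<open>0 \<le> L\<close> in simp)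
    then have "\<bar>f x - f y\<bar> / d x y / (L + B) \<le> L / (L + B)"
      using pos by (intro divide_right_mono) auto
    then show "\<bar>f x / (L + B) - f y / (L + B)\<bar> / d x y \<le> L / (L + B)"
      using pos by (simp add: diff_divide_distrib[symmetric] mult.commute)
  next
    fix x assume "x \<in> X"
    then show "\<bar>f x / (L + B)\<bar> \<le> B / (L + B)"
      using bound[of x] pos by (simp add: divide_right_mono)
  qed (use assms pos in \<open>auto simp: add_divide_distrib[symmetric]\<close>)
  then have "\<bar>(\<integral>x. f x / (L + B) \<partial>\<mu>) - (\<integral>x. f x / (L + B) \<partial>\<nu>)\<bar> \<le> dBL X d \<mu> \<nu>"
    using assms by (intro abs_integral_diff_le_dBL) auto
  then have "\<bar>(\<integral>x. f x \<partial>\<mu>) - (\<integral>x. f x \<partial>\<nu>)\<bar> / (L + B) \<le> dBL X d \<mu> \<nu>"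
    using pos by (simp add: diff_divide_distrib[symmetric])
  then show ?thesis
    using pos by (simp add: divide_le_eq mult.commute)
qed

lemma dBL_nonneg:
  assumes "prob_space \<mu>" "prob_space \<nu>" "space \<mu> = X" "space \<nu> = X"
  shows "0 \<le> dBL X d \<mu> \<nu>"
proof -
  have "bl_norm X d (\<lambda>_. 0) \<le> 1"
    by (rule bl_norm_leI[where L = 0 and B = 0]) auto
  from abs_integral_diff_le_dBL[OF assms this] show ?thesis by simp
qed

text \<open>On a metric space the bounded Lipschitz metric separates Borel probability measures: the indicator
  of a closed set is the pointwise limit of the Lipschitz ramps \<open>max 0 (1 - k * infdist x C)\<close>, and
  the closed sets are an intersection-stable generator of the Borel sets.  This matters for test
  functions on the space of measures, because their norm involves quotients with the denominator
  \<open>dBL UNIV dist \<mu> \<nu>\<close>: these quotients say something about every pair \<open>\<mu> \<noteq> \<nu>\<close> only if the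
  denominator is then positive.\<close>

lemma dBL_eq_0_imp_eq:
  fixes \<mu> \<nu> :: "'a :: metric_space measure"
  assumes "\<mu> \<in> prob_measures borel" "\<nu> \<in> prob_measures borel"
    and "dBL UNIV dist \<mu> \<nu> = 0"
  shows "\<mu> = \<nu>"
proof -
  have sets [measurable_cong, simp]: "sets \<mu> = sets borel" "sets \<nu> = sets borel"
    and prob: "prob_space \<mu>" "prob_space \<nu>"
    using assms by (auto simp: prob_measures_def)
  have space: "space \<mu> = UNIV" "space \<nu> = UNIV"
    using sets_eq_imp_space_eq[OF sets(1)] sets_eq_imp_space_eq[OF sets(2)] by auto
  interpret \<mu>: prob_space \<mu> by fact
  interpret \<nu>: prob_space \<nu> by fact
  have closed_eq: "measure \<mu> C = measure \<nu> C" if C: "closed C" for C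
  proof (cases "C = {}")
    case False
    define f where "f k x = max 0 (1 - real k * infdist x C)" for k x
    have [measurable]: "f k \<in> borel_measurable borel" for k
      unfolding f_def by (intro borel_measurable_continuous_onI continuous_intros)
    have [measurable]: "C \<in> sets borel"
      using C by simp
    have f_bound: "\<bar>f k x\<bar> \<le> 1" for k x
      using infdist_nonneg[of x C] by (auto simp: f_def)
    have f_Lip: "\<bar>f k x - f k y\<bar> \<le> real k * dist x y" for k x y
    proof -
      have "\<bar>f k x - f k y\<bar> \<le> \<bar>real k * infdist x C - real k * infdist y C\<bar>"
        by (auto simp: f_def max_def)
      also have "\<dots> = real k * \<bar>infdist x C - infdist y C\<bar>"
        by (simp add: abs_mult right_diff_distrib[symmetric])
      also have "\<dots> \<le> real k * dist x y"
        using infdist_triangle_abs[of x C y] by (intro mult_left_mono) auto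
      finally show ?thesis .
    qed
    have f_lim: "(\<lambda>k. f k x) \<longlonglongrightarrow> indicator C x" for x
    proof (cases "x \<in> C")
      case True
      then show ?thesis by (simp add: f_def)
    next
      case False
      then have pos: "0 < infdist x C"
        using C \<open>C \<noteq> {}\<close> in_closed_iff_infdist_zero[of C x] infdist_nonneg[of x C] by force
      obtain N where N: "1 < real N * infdist x C"
        using ex_less_of_nat_mult[OF pos] by blast
      have "f k x = 0" if "N \<le> k" for k
      proof -
        have "real N * infdist x C \<le> real k * infdist x C"
          using that pos by (intro mult_right_mono) auto
        then show ?thesis using N by (simp add: f_def)
      qed
      then have "eventually (\<lambda>k. f k x = 0) sequentially"
        by (auto simp: eventually_sequentially)
      then show ?thesis
        using False by (simp add: tendsto_eventually)
    qed
    have eq: "(\<integral>x. f k x \<partial>\<mu>) = (\<integral>x. f k x \<partial>\<nu>)" for k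
      using abs_integral_diff_le_scaled_dBL[OF prob space, of "f k" "real k" dist 1] f_Lip f_bound assms(3)
      by simp
    have "(\<lambda>k. \<integral>x. f k x \<partial>\<mu>) \<longlonglongrightarrow> (\<integral>x. indicator C x \<partial>\<mu>)"
      by (rule integral_dominated_convergence[where w = "\<lambda>_. 1"]) (use f_lim f_bound in auto)
    moreover have "(\<lambda>k. \<integral>x. f k x \<partial>\<nu>) \<longlonglongrightarrow> (\<integral>x. indicator C x \<partial>\<nu>)"
      by (rule integral_dominated_convergence[where w = "\<lambda>_. 1"]) (use f_lim f_bound in auto)
    ultimately have "(\<integral>x. indicator C x \<partial>\<mu>) = (\<integral>x. indicat_real C x \<partial>\<nu>)"
      using LIMSEQ_unique unfolding eq by blast
    then show ?thesis
      by (simp add: space)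
  qed simp
  show ?thesis
  proof (rule measure_eqI_generator_eq[where E = "Collect closed" and \<Omega> = UNIV and A = "\<lambda>_. UNIV"])
    show "sets \<mu> = sigma_sets UNIV (Collect closed)" "sets \<nu> = sigma_sets UNIV (Collect closed)"
      by (simp_all add: borel_eq_closed)
    fix C assume "C \<in> Collect (closed :: 'a set \<Rightarrow> bool)"
    then show "emeasure \<mu> C = emeasure \<nu> C"
      by (simp add: \<mu>.emeasure_eq_measure \<nu>.emeasure_eq_measure closed_eq)
  qed (auto simp: Int_stable_def)
qed

section \<open>Inf-convolution\<close>

text \<open>The McShane construction.  A function that is Lipschitz up to an error \<open>e\<close> need not even be
  continuous, but its inf-convolution with \<open>L * \<rho>\<close> is genuinely \<open>L\<close>-Lipschitz and moves the values
  by at most \<open>e\<close>.\<close>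

lemma almost_Lipschitz_approx:
  fixes g :: "'a \<Rightarrow> real" and \<rho> :: "'a \<Rightarrow> 'a \<Rightarrow> real"
  assumes refl: "\<And>x. \<rho> x x = 0" and sym: "\<And>x y. \<rho> x y = \<rho> y x"
    and tri: "\<And>x y z. \<rho> x z \<le> \<rho> x y + \<rho> y z"
    and nonneg: "\<And>x y. 0 \<le> \<rho> x y"
    and bound: "\<And>x. x \<in> X \<Longrightarrow> \<bar>g x\<bar> \<le> B"
    and almost: "\<And>x y. x \<in> X \<Longrightarrow> y \<in> X \<Longrightarrow> g x - g y \<le> e + L * \<rho> x y"
    and "0 \<le> L"
  obtains h where "\<And>x y. x \<in> X \<Longrightarrow> y \<in> X \<Longrightarrow> \<bar>h x - h y\<bar> \<le> L * \<rho> x y"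
    and "\<And>x. x \<in> X \<Longrightarrow> g x - e \<le> h x \<and> h x \<le> g x"
proof
  define h where "h x = (INF y\<in>X. g y + L * \<rho> x y)" for x
  have bdd: "bdd_below ((\<lambda>y. g y + L * \<rho> x y) ` X)" for x
  proof (rule bdd_belowI2)
    fix y assume "y \<in> X"
    then show "- B \<le> g y + L * \<rho> x y"
      using bound[of y] mult_nonneg_nonneg[OF \<open>0 \<le> L\<close> nonneg[of x y]] by linarith
  qed
  have one_sided: "h x - h y \<le> L * \<rho> x y" if X: "x \<in> X" for x y
  proof -
    have "h x - L * \<rho> x y \<le> g z + L * \<rho> y z" if z: "z \<in> X" for z
    proof -
      have "h x \<le> g z + L * \<rho> x z"
        unfolding h_def by (intro cINF_lower bdd z)
      also have "\<dots> \<le> g z + L * (\<rho> x y + \<rho> y z)"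
        using tri \<open>0 \<le> L\<close> by (intro add_left_mono mult_left_mono) auto
      finally show ?thesis by (simp add: algebra_simps)
    qed
    then have "h x - L * \<rho> x y \<le> h y"
      unfolding h_def[of y] using X by (intro cINF_greatest) auto
    then show ?thesis by simp
  qed
  show "\<bar>h x - h y\<bar> \<le> L * \<rho> x y" if "x \<in> X" "y \<in> X" for x y
    using one_sided[of x y] one_sided[of y x] that by (simp add: sym[of y x])
  show "g x - e \<le> h x \<and> h x \<le> g x" if X: "x \<in> X" for x
  proof
    show "g x - e \<le> h x"
      unfolding h_def
    proof (rule cINF_greatest)
      fix y assume "y \<in> X"
      then show "g x - e \<le> g y + L * \<rho> x y"
        using almost[OF X, of y] by simp
    qed (use X in auto)
    have "h x \<le> g x + L * \<rho> x x"
      unfolding h_def by (intro cINF_lower bdd X)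
    then show "h x \<le> g x"
      by (simp add: refl)
  qed
qed

section \<open>Tuples in the unit cube\<close>

lemma space_cubeM [simp]: "space cubeM = unit_cube"
  by (simp add: cubeM_def space_restrict_space)

lemma space_tupleM: "space (tupleM n) = tuples n"
  by (simp add: space_PiM)

lemma bounded_unit_cube: "bounded (unit_cube :: (real ^ 'd) set)"
proof -
  have "(unit_cube :: (real ^ 'd) set) = cbox 0 1"
    by (auto simp: unit_cube_def mem_box_cart)
  show ?thesis
    unfolding \<open>unit_cube = cbox 0 1\<close> by (rule bounded_cbox)
qed

lemma continuous_on_imp_measurable_cubeM:
  assumes "continuous_on unit_cube f"
  shows "f \<in> borel_measurable cubeM"
  unfolding cubeM_def using assms by (rule borel_measurable_continuous_on_restrict)

text \<open>For a countable index set the Borel sets of the full product \<open>nat \<Rightarrow> real ^ 'd\<close> are the product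
  \<open>\<sigma>\<close>-algebra.  Tuples are functions that are constant (\<open>undefined\<close>) off \<open>{1..n}\<close>, so they embed
  measurably into that full product.\<close>

lemma openin_tuples_imp_sets:
  assumes "openin (top_of_set (tuples n)) V"
  shows "V \<in> sets (tupleM n :: (nat \<Rightarrow> real ^ 'd) measure)"
proof -
  obtain W where W: "open W" "V = tuples n \<inter> W"
    using assms by (auto simp: openin_open)
  have "(\<lambda>z. z) \<in> measurable (tupleM n) (PiM UNIV (\<lambda>_. borel :: (real ^ 'd) measure))"
  proof (rule measurable_PiM_single')
    fix i
    show "(\<lambda>z. z i) \<in> borel_measurable (tupleM n :: (nat \<Rightarrow> real ^ 'd) measure)"
    proof (cases "i \<in> {1..n}")
      case True
      have "(\<lambda>x. x) \<in> borel_measurable (cubeM :: (real ^ 'd) measure)"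
        by (rule continuous_on_imp_measurable_cubeM) simp
      then show ?thesis
        by (rule measurable_compose[OF measurable_component_singleton[OF True]])
    next
      case False
      have "(\<lambda>z. z i) \<in> borel_measurable (tupleM n :: (nat \<Rightarrow> real ^ 'd) measure)
        \<longleftrightarrow> (\<lambda>z. undefined :: real ^ 'd) \<in> borel_measurable (tupleM n :: (nat \<Rightarrow> real ^ 'd) measure)"
        using False by (intro measurable_cong) (unfold space_tupleM, rule PiE_arb)
      then show ?thesis by simp
    qed
  qed auto
  moreover have "W \<in> sets (PiM UNIV (\<lambda>_. borel :: (real ^ 'd) measure) :: (nat \<Rightarrow> real ^ 'd) measure)"
    using W(1) unfolding sets_PiM_equal_borel by simp
  ultimately have "(\<lambda>z. z) -` W \<inter> space (tupleM n) \<in> sets (tupleM n :: (nat \<Rightarrow> real ^ 'd) measure)"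
    by (rule measurable_sets)
  then show ?thesis
    unfolding space_tupleM W(2) vimage_ident by (subst Int_commute)
qed

lemma continuous_on_tuples_imp_measurable:
  fixes f :: "(nat \<Rightarrow> real ^ 'd) \<Rightarrow> 'h :: topological_space"
  assumes "continuous_on (tuples n) f"
  shows "f \<in> borel_measurable (tupleM n)"
proof (rule borel_measurableI)
  fix U :: "'h set" assume U: "open U"
  have "tuples n \<inter> f -` U \<in> sets (tupleM n)"
    by (intro openin_tuples_imp_sets continuous_openin_preimage_gen assms U)
  then show "f -` U \<inter> space (tupleM n) \<in> sets (tupleM n)"
    unfolding space_tupleM by (simp only: Int_commute)
qed

text \<open>The distance \<open>tuple_dist\<close> is of Ky Fan type and awkward to average.  The mean of the coordinate
  distances is dominated by it on the bounded cube and is linear in the empirical measure of the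
  pairs of coordinates, which makes its expectation under random reindexing computable.\<close>

definition mean_dist :: "nat \<Rightarrow> (nat \<Rightarrow> 'a :: metric_space) \<Rightarrow> (nat \<Rightarrow> 'a) \<Rightarrow> real" where
  "mean_dist n z z' = (\<Sum>i = 1..n. dist (z i) (z' i)) / real n"

lemma mean_dist_self: "mean_dist n z z = 0"
  by (simp add: mean_dist_def)

lemma mean_dist_commute: "mean_dist n z z' = mean_dist n z' z"
  by (simp add: mean_dist_def dist_commute)

lemma mean_dist_nonneg: "0 \<le> mean_dist n z z'"
  by (simp add: mean_dist_def sum_nonneg)

lemma mean_dist_triangle: "mean_dist n x z \<le> mean_dist n x y + mean_dist n y z"
  unfolding mean_dist_def add_divide_distrib[symmetric] sum.distrib[symmetric]
  by (intro divide_right_mono sum_mono dist_triangle) auto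

lemma tuple_dist_set_nonempty:
  "{\<epsilon>. \<epsilon> > 0 \<and> real (card {i \<in> {1..n}. dist (z i) (z' i) \<ge> \<epsilon>}) / real n \<le> \<epsilon>} \<noteq> {}"
proof -
  have "card {i \<in> {1..n}. dist (z i) (z' i) \<ge> 1} \<le> card {1..n}"
    by (intro card_mono) auto
  then have "real (card {i \<in> {1..n}. dist (z i) (z' i) \<ge> 1}) / real n \<le> 1"
    by (cases "n = 0") (auto simp: divide_le_eq_1)
  then have "1 \<in> {\<epsilon>. \<epsilon> > 0 \<and> real (card {i \<in> {1..n}. dist (z i) (z' i) \<ge> \<epsilon>}) / real n \<le> \<epsilon>}"
    by (intro CollectI conjI) auto
  then show ?thesis by blast
qed

lemma tuple_dist_nonneg: "0 \<le> tuple_dist n z z'"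
  unfolding tuple_dist_def by (rule cInf_greatest[OF tuple_dist_set_nonempty]) auto

text \<open>Let \<open>\<epsilon>\<close> be admissible in the infimum that defines \<open>tuple_dist\<close>.  The coordinates at distance less
  than \<open>\<epsilon>\<close> contribute at most \<open>\<epsilon>\<close> to the mean; the others make up a fraction of at most \<open>\<epsilon>\<close> and
  each is at most a diameter apart.\<close>

lemma mean_dist_le_tuple_dist:
  fixes z z' :: "nat \<Rightarrow> real ^ 'd"
  assumes "1 \<le> n" "z \<in> tuples n" "z' \<in> tuples n"
  shows "mean_dist n z z' \<le> (1 + diameter (unit_cube :: (real ^ 'd) set)) * tuple_dist n z z'"
proof -
  let ?D = "diameter (unit_cube :: (real ^ 'd) set)"
  let ?E = "{\<epsilon>. \<epsilon> > 0 \<and> real (card {i \<in> {1..n}. dist (z i) (z' i) \<ge> \<epsilon>}) / real n \<le> \<epsilon>}"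
  have D: "0 \<le> ?D"
    by (rule diameter_ge_0[OF bounded_unit_cube])
  have le: "mean_dist n z z' / (1 + ?D) \<le> \<epsilon>" if \<epsilon>: "\<epsilon> \<in> ?E" for \<epsilon>
  proof -
    let ?A = "{i \<in> {1..n}. dist (z i) (z' i) \<ge> \<epsilon>}"
    have "dist (z i) (z' i) \<le> \<epsilon> + ?D * indicator ?A i" if i: "i \<in> {1..n}" for i
    proof (cases "i \<in> ?A")
      case True
      have "dist (z i) (z' i) \<le> ?D"
        using assms i by (intro diameter_bounded_bound[OF bounded_unit_cube]) (auto simp: PiE_def)
      then show ?thesis using True \<epsilon> by simp
    next
      case False
      then show ?thesis using i D by (auto simp: indicator_def)
    qed
    then have "(\<Sum>i = 1..n. dist (z i) (z' i)) \<le> (\<Sum>i = 1..n. \<epsilon> + ?D * indicator ?A i)"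
      by (rule sum_mono)
    also have "\<dots> = real n * \<epsilon> + ?D * (\<Sum>i = 1..n. indicat_real ?A i)"
      by (simp only: sum.distrib sum_distrib_left sum_constant card_atLeastAtMost) simp
    also have "(\<Sum>i = 1..n. indicat_real ?A i) = (\<Sum>i\<in>?A. 1)"
      by (rule sum.mono_neutral_cong_right) auto
    also have "\<dots> = real (card ?A)"
      by (simp only: sum_constant mult_1_right of_nat_id)
    finally have "mean_dist n z z' \<le> (real n * \<epsilon> + ?D * real (card ?A)) / real n"
      unfolding mean_dist_def by (rule divide_right_mono) simp
    also have "\<dots> = \<epsilon> + ?D * (real (card ?A) / real n)"
      using assms(1) by (simp add: add_divide_distrib)
    also have "\<dots> \<le> \<epsilon> + ?D * \<epsilon>"
      using \<epsilon> D by (intro add_left_mono mult_left_mono) auto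
    finally show ?thesis
      using D by (simp add: divide_le_eq algebra_simps)
  qed
  have "mean_dist n z z' / (1 + ?D) \<le> tuple_dist n z z'"
    unfolding tuple_dist_def by (rule cInf_greatest[OF tuple_dist_set_nonempty le])
  then show ?thesis
    using D by (simp add: divide_le_eq mult.commute)
qed

lemma mean_dist_Lipschitz_imp_continuous_on:
  fixes h :: "(nat \<Rightarrow> 'a :: metric_space) \<Rightarrow> real"
  assumes "\<And>z z'. z \<in> X \<Longrightarrow> z' \<in> X \<Longrightarrow> \<bar>h z - h z'\<bar> \<le> L * mean_dist n z z'"
  shows "continuous_on X h"
  unfolding continuous_on_def
proof
  fix z assume z: "z \<in> X"
  have "continuous_on UNIV (\<lambda>z'. L * mean_dist n z' z)"
    unfolding mean_dist_def divide_inverse by (intro continuous_intros continuous_on_product_coordinates)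
  then have "((\<lambda>z'. L * mean_dist n z' z) \<longlongrightarrow> L * mean_dist n z z) (at z within X)"
    unfolding continuous_on_def using tendsto_within_subset by blast
  then have "((\<lambda>z'. L * mean_dist n z' z) \<longlongrightarrow> 0) (at z within X)"
    by (simp add: mean_dist_self)
  moreover have "eventually (\<lambda>z'. norm (h z' - h z) \<le> L * mean_dist n z' z) (at z within X)"
    unfolding eventually_at_filter real_norm_def
    by (intro always_eventually allI impI assms z)
  ultimately have "((\<lambda>z'. h z' - h z) \<longlongrightarrow> 0) (at z within X)"
    by (rule Lim_null_comparison[rotated])
  then show "(h \<longlongrightarrow> h z) (at z within X)"
    by (simp add: LIM_zero_cancel)
qed

text \<open>Both resampling stages (the blocks, and the independent draws from the empirical measure of the
  block sample) replace a tuple by a reindexed tuple with random indices.\<close>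

definition reindex :: "nat \<Rightarrow> (nat \<Rightarrow> 'a) \<Rightarrow> (nat \<Rightarrow> nat) \<Rightarrow> nat \<Rightarrow> 'a" where
  "reindex n z \<sigma> = (\<lambda>t\<in>{1..n}. z (\<sigma> t))"

lemma reindex_in_tuples:
  assumes "z \<in> tuples n" "\<sigma> \<in> {1..n} \<rightarrow> {1..n}"
  shows "reindex n z \<sigma> \<in> tuples n"
  unfolding reindex_def restrict_PiE_iff using assms by (blast intro: PiE_mem funcset_mem)

lemma continuous_on_reindex:
  "continuous_on X (\<lambda>z :: nat \<Rightarrow> 'a :: topological_space. reindex n z \<sigma>)"
proof (rule continuous_on_coordinatewise_then_product)
  fix t
  show "continuous_on X (\<lambda>z :: nat \<Rightarrow> 'a. reindex n z \<sigma> t)"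
  proof (cases "t \<in> {1..n}")
    case True
    then show ?thesis
      using continuous_on_product_then_coordinatewise[OF continuous_on_id, of X "\<sigma> t"]
      by (simp add: reindex_def)
  next
    case False
    then show ?thesis
      by (simp only: reindex_def restrict_apply if_False continuous_on_const)
  qed
qed

section \<open>Uniform index draws\<close>

lemma prob_space_boot_draws: "1 \<le> n \<Longrightarrow> prob_space (boot_draws n l)"
  unfolding boot_draws_def by (intro prob_space_PiM prob_space_uniform_count_measure) auto

text \<open>The space of index draws is finite and discrete, so every function on it is measurable and
  integrable.\<close>

lemma sets_boot_draws: "sets (boot_draws n l) = Pow ({1..l} \<rightarrow>\<^sub>E {1..n})"
proof -
  have "sets (boot_draws n l) = sets (PiM {1..l} (\<lambda>_. count_space {1..n}))"
    unfolding boot_draws_def by (intro sets_PiM_cong) (auto simp: sets_uniform_count_measure)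
  then show ?thesis
    by (simp add: count_space_PiM_finite)
qed

lemma space_boot_draws: "space (boot_draws n l) = {1..l} \<rightarrow>\<^sub>E {1..n}"
  using sets_eq_imp_space_eq[of "boot_draws n l" "count_space ({1..l} \<rightarrow>\<^sub>E {1..n})"]
  by (simp add: sets_boot_draws)

lemma finite_space_boot_draws: "finite (space (boot_draws n l))"
  unfolding space_boot_draws by (intro finite_PiE) auto

lemma measurable_boot_draws:
  "f \<in> measurable (boot_draws n l) N \<longleftrightarrow> f \<in> space (boot_draws n l) \<rightarrow> space N"
  by (auto simp: measurable_def sets_boot_draws space_boot_draws)

lemma integrable_boot_draws:
  fixes f :: "(nat \<Rightarrow> nat) \<Rightarrow> real"
  assumes "1 \<le> n"
  shows "integrable (boot_draws n l) f"
proof -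
  interpret prob_space "boot_draws n l"
    using assms by (rule prob_space_boot_draws)
  show ?thesis
    by (rule integrable_const_bound[where B = "Max ((\<lambda>x. \<bar>f x\<bar>) ` space (boot_draws n l))"])
       (auto intro!: AE_I2 Max_ge simp: finite_space_boot_draws measurable_boot_draws)
qed

lemma integral_finite_space_eq_sum:
  fixes f :: "'a \<Rightarrow> real"
  assumes "finite_measure M" "finite (space M)" "sets M = Pow (space M)"
  shows "(\<integral>x. f x \<partial>M) = (\<Sum>x\<in>space M. measure M {x} * f x)"
proof -
  interpret finite_measure M by fact
  have "(\<integral>x. f x \<partial>M) = (\<integral>x. (\<Sum>y\<in>space M. indicator {y} x * f y) \<partial>M)"
  proof (rule Bochner_Integration.integral_cong[OF refl])
    fix x assume "x \<in> space M"
    then have "(\<Sum>y\<in>space M. indicator {y} x * f y) = (\<Sum>y\<in>{x}. indicator {y} x * f y)"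
      using assms by (intro sum.mono_neutral_right) (auto simp: indicator_def)
    then show "f x = (\<Sum>y\<in>space M. indicator {y} x * f y)"
      by simp
  qed
  also have "\<dots> = (\<Sum>y\<in>space M. \<integral>x. indicator {y} x * f y \<partial>M)"
    using assms
    by (intro Bochner_Integration.integral_sum integrable_mult_left integrable_real_indicator)
       (auto simp: less_top[symmetric])
  also have "\<dots> = (\<Sum>y\<in>space M. measure M {y} * f y)"
    by (intro sum.cong) auto
  finally show ?thesis .
qed

lemma integral_boot_draws_component:
  fixes h :: "nat \<Rightarrow> real"
  assumes "1 \<le> n" "k \<in> {1..l}"
  shows "(\<integral>I. h (I k) \<partial>boot_draws n l) = (\<Sum>i = 1..n. h i) / real n"
proof -
  let ?U = "uniform_count_measure {1..n}"
  have "(\<integral>I. h (I k) \<partial>boot_draws n l) = (\<integral>i. h i \<partial>distr (boot_draws n l) ?U (\<lambda>I. I k))"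
  proof (rule integral_distr[symmetric])
    show "(\<lambda>I. I k) \<in> measurable (boot_draws n l) ?U"
      using assms(2)
      by (auto simp: measurable_boot_draws space_boot_draws space_uniform_count_measure PiE_def Pi_def)
    show "h \<in> borel_measurable ?U"
      by (auto simp: measurable_def sets_uniform_count_measure space_uniform_count_measure)
  qed
  also have "distr (boot_draws n l) ?U (\<lambda>I. I k) = ?U"
    unfolding boot_draws_def using assms
    by (intro distr_PiM_component prob_space_uniform_count_measure) auto
  finally show ?thesis
    by (simp add: integral_uniform_count_measure)
qed

text \<open>If each single index \<open>\<sigma> I t\<close> is uniformly distributed on \<open>{1..n}\<close>, then
  reindexing two tuples with the same random indices preserves their mean distance in expectation.
  Only the one-dimensional marginals of the indices enter, by linearity, so that the dependence
  inside a block does no harm.\<close>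

lemma expected_mean_dist_reindex:
  assumes "1 \<le> n"
    and unif: "\<And>t h. t \<in> {1..n} \<Longrightarrow>
      (\<integral>I. h (\<sigma> I t) \<partial>boot_draws n l) = (\<Sum>i = 1..n. h i) / real n"
  shows "(\<integral>I. mean_dist n (reindex n z (\<sigma> I)) (reindex n z' (\<sigma> I)) \<partial>boot_draws n l)
    = mean_dist n z z'"
proof -
  have "(\<integral>I. mean_dist n (reindex n z (\<sigma> I)) (reindex n z' (\<sigma> I)) \<partial>boot_draws n l)
    = (\<integral>I. (\<Sum>t = 1..n. dist (z (\<sigma> I t)) (z' (\<sigma> I t))) / real n \<partial>boot_draws n l)"
    by (simp add: mean_dist_def reindex_def)
  also have "\<dots> = (\<Sum>t = 1..n. \<integral>I. dist (z (\<sigma> I t)) (z' (\<sigma> I t)) \<partial>boot_draws n l) / real n"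
    by (simp add: Bochner_Integration.integral_sum integrable_boot_draws[OF assms(1)])
  also have "\<dots> = (\<Sum>t = 1..n. mean_dist n z z') / real n"
    using unif[of _ "\<lambda>i. dist (z i) (z' i)"] by (simp add: mean_dist_def)
  finally show ?thesis
    using assms(1) by simp
qed

section \<open>The law of the statistic under resampling\<close>

lemma empirical_eq_distr:
  fixes z :: "nat \<Rightarrow> real ^ 'd"
  assumes "1 \<le> n" "z \<in> tuples n"
  shows "empirical n z = distr (uniform_count_measure {1..n}) cubeM z"
  unfolding empirical_def distr_def
proof (rule measure_of_eq[OF sets.space_closed])
  fix A :: "(real ^ 'd) set" assume "A \<in> sigma_sets (space cubeM) (sets cubeM)"
  then have A: "A \<in> sets cubeM"
    by (simp only: sets.sigma_sets_eq)
  let ?N = "{i \<in> {1..n}. z i \<in> A}"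
  have "(\<Sum>i = 1..n. emeasure (return cubeM (z i)) A) = (\<Sum>i = 1..n. indicator A (z i))"
    using A by (intro sum.cong) auto
  also have "\<dots> = (\<Sum>i\<in>?N. 1)"
    by (rule sum.mono_neutral_cong_right) auto
  also have "\<dots> = ennreal (real (card ?N))"
    by (simp only: sum_constant mult_1_right ennreal_of_nat_eq_real_of_nat)
  finally have "(\<Sum>i = 1..n. emeasure (return cubeM (z i)) A) / of_nat n
      = ennreal (real (card ?N)) / ennreal (real n)"
    by (simp add: ennreal_of_nat_eq_real_of_nat)
  also have "\<dots> = ennreal (real (card ?N) / real n)"
    using assms(1) by (intro divide_ennreal) auto
  also have "\<dots> = emeasure (uniform_count_measure {1..n}) ?N"
    by (subst emeasure_uniform_count_measure) auto
  also have "?N = z -` A \<inter> space (uniform_count_measure {1..n})"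
    by (auto simp: space_uniform_count_measure)
  finally show "(\<Sum>i = 1..n. emeasure (return cubeM (z i)) A) / of_nat n
      = emeasure (uniform_count_measure {1..n}) (z -` A \<inter> space (uniform_count_measure {1..n}))" .
qed

lemma measurable_tuple_cubeM:
  assumes "z \<in> tuples n"
  shows "z \<in> measurable (uniform_count_measure {1..n}) (cubeM :: (real ^ 'd) measure)"
  using assms by (auto simp: measurable_def sets_uniform_count_measure space_uniform_count_measure)

lemma empirical_in_prob_measures:
  fixes z :: "nat \<Rightarrow> real ^ 'd"
  assumes "1 \<le> n" "z \<in> tuples n"
  shows "empirical n z \<in> prob_measures cubeM"
proof -
  interpret prob_space "uniform_count_measure {1..n}"
    using assms(1) by (intro prob_space_uniform_count_measure) auto
  show ?thesis
    unfolding empirical_eq_distr[OF assms] prob_measures_def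
    using prob_space_distr[OF measurable_tuple_cubeM[OF assms(2)]] by simp
qed

text \<open>Matching the \<open>i\<close>-th atoms is a coupling of the two empirical measures with transport cost
  \<open>mean_dist n z z'\<close>.\<close>

lemma dBL_empirical_le_mean_dist:
  fixes z z' :: "nat \<Rightarrow> real ^ 'd"
  assumes "1 \<le> n" "z \<in> tuples n" "z' \<in> tuples n"
  shows "dBL unit_cube dist (empirical n z) (empirical n z') \<le> mean_dist n z z'"
proof (rule dBL_leI)
  fix f :: "real ^ 'd \<Rightarrow> real" assume f: "bl_norm unit_cube dist f \<le> 1"
  have meas: "f \<in> borel_measurable cubeM"
    by (intro continuous_on_imp_measurable_cubeM bl_norm_imp_continuous_on f)
  have int: "(\<integral>x. f x \<partial>empirical n w) = (\<Sum>i = 1..n. f (w i)) / real n" if "w \<in> tuples n" for w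
    unfolding empirical_eq_distr[OF assms(1) that]
    by (subst integral_distr[OF measurable_tuple_cubeM[OF that] meas])
       (simp add: integral_uniform_count_measure)
  have "\<bar>(\<integral>x. f x \<partial>empirical n z) - (\<integral>x. f x \<partial>empirical n z')\<bar>
      = \<bar>\<Sum>i = 1..n. f (z i) - f (z' i)\<bar> / real n"
    unfolding int[OF assms(2)] int[OF assms(3)]
    by (simp add: sum_subtractf diff_divide_distrib[symmetric])
  also have "\<dots> \<le> (\<Sum>i = 1..n. \<bar>f (z i) - f (z' i)\<bar>) / real n"
    by (intro divide_right_mono sum_abs) auto
  also have "\<dots> \<le> mean_dist n z z'"
    unfolding mean_dist_def using assms
    by (intro divide_right_mono sum_mono bl_norm_imp_Lipschitz[OF f]) (auto simp: PiE_def)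
  finally show "\<bar>(\<integral>x. f x \<partial>empirical n z) - (\<integral>x. f x \<partial>empirical n z')\<bar> \<le> mean_dist n z z'" .
qed

text \<open>Drawing \<open>n\<close> independent points from the empirical measure of \<open>z\<close> amounts to drawing \<open>n\<close> independent
  uniform indices.  The index space does not depend on \<open>z\<close>, which couples the approximations that
  belong to different tuples.\<close>

lemma boot_approx_eq_distr:
  fixes z :: "nat \<Rightarrow> real ^ 'd"
  assumes "1 \<le> n" "z \<in> tuples n"
  shows "boot_approx n z = distr (boot_draws n n) (tupleM n) (reindex n z)"
proof -
  have *: "compose {1..n} z = reindex n z"
    by (auto simp: compose_def reindex_def fun_eq_iff)
  obtain x :: "real ^ 'd" where "x \<in> unit_cube"
    using PiE_mem[OF assms(2), of 1] assms(1) by auto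
  \<comment> \<open>Only the \<open>\<sigma>\<close>-algebra of the target of \<open>distr\<close> matters.  A point mass makes the target a
      probability space, as \<open>distr_PiM_finite_prob_space'\<close> asks for.\<close>
  have "boot_approx n z = PiM {1..n} (\<lambda>_. distr (uniform_count_measure {1..n}) (return cubeM x) z)"
    unfolding boot_approx_def empirical_eq_distr[OF assms]
    by (intro PiM_cong distr_cong) auto
  also have "\<dots> = distr (boot_draws n n) (PiM {1..n} (\<lambda>_. return cubeM x)) (compose {1..n} z)"
    unfolding boot_draws_def
    using assms measurable_tuple_cubeM[OF assms(2)] \<open>x \<in> unit_cube\<close>
    by (intro distr_PiM_finite_prob_space'[symmetric] prob_space_uniform_count_measure
        prob_space_return) auto
  also have "\<dots> = distr (boot_draws n n) (tupleM n) (reindex n z)"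
    unfolding * by (intro distr_cong sets_PiM_cong) auto
  finally show ?thesis .
qed

definition plug_in_law ::
  "nat \<Rightarrow> ((nat \<Rightarrow> real ^ 'd) \<Rightarrow> 'h :: topological_space) \<Rightarrow> (nat \<Rightarrow> real ^ 'd) \<Rightarrow> 'h measure" where
  "plug_in_law n T z = distr (boot_approx n z) borel T"

lemma space_boot_draws_imp_Pi:
  "J \<in> space (boot_draws n n) \<Longrightarrow> J \<in> {1..n} \<rightarrow> {1..n}"
  by (auto simp: space_boot_draws)

lemma plug_in_law_eq_distr:
  fixes z :: "nat \<Rightarrow> real ^ 'd" and T :: "(nat \<Rightarrow> real ^ 'd) \<Rightarrow> 'h :: topological_space"
  assumes "1 \<le> n" "z \<in> tuples n" "continuous_on (tuples n) T"
  shows "plug_in_law n T z = distr (boot_draws n n) borel (\<lambda>J. T (reindex n z J))"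
proof -
  have "reindex n z \<in> measurable (boot_draws n n) (tupleM n)"
    unfolding measurable_boot_draws space_tupleM
    by (intro funcsetI reindex_in_tuples space_boot_draws_imp_Pi assms)
  then show ?thesis
    unfolding plug_in_law_def boot_approx_eq_distr[OF assms(1,2)]
    by (subst distr_distr) (use continuous_on_tuples_imp_measurable[OF assms(3)] in \<open>auto simp: o_def\<close>)
qed

lemma plug_in_law_in_prob_measures:
  assumes "1 \<le> n" "z \<in> tuples n" "continuous_on (tuples n) T"
  shows "plug_in_law n T z \<in> prob_measures borel"
  unfolding plug_in_law_eq_distr[OF assms] prob_measures_def
  using prob_space_boot_draws[OF assms(1)]
  by (auto intro!: prob_space.prob_space_distr simp: measurable_boot_draws)

lemma integral_plug_in_law:
  fixes f :: "'h :: topological_space \<Rightarrow> real"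
  assumes "1 \<le> n" "z \<in> tuples n" "continuous_on (tuples n) T" "continuous_on UNIV f"
  shows "(\<integral>x. f x \<partial>plug_in_law n T z) = (\<integral>J. f (T (reindex n z J)) \<partial>boot_draws n n)"
  unfolding plug_in_law_eq_distr[OF assms(1-3)]
  using assms(4)
  by (intro integral_distr borel_measurable_continuous_onI) (auto simp: measurable_boot_draws)

text \<open>Coupling through common indices.  For a draw of indices \<open>J\<close>, either the reindexed tuples are closer
  than \<open>\<delta>\<close> and the values of \<open>T\<close> differ by at most \<open>\<epsilon>\<close>, or the factor \<open>2 / \<delta>\<close> makes the right-hand
  side at least 2, the trivial bound for a test function.  Averaging over \<open>J\<close> removes the
  reindexing.\<close>

lemma dBL_plug_in_law_le:
  fixes z z' :: "nat \<Rightarrow> real ^ 'd" and T :: "(nat \<Rightarrow> real ^ 'd) \<Rightarrow> 'h :: metric_space"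
  assumes n: "1 \<le> n" and z: "z \<in> tuples n" "z' \<in> tuples n" and cont: "continuous_on (tuples n) T"
    and "0 < \<delta>" "0 \<le> \<epsilon>"
    and unif: "\<And>w w'. w \<in> tuples n \<Longrightarrow> w' \<in> tuples n \<Longrightarrow> mean_dist n w w' < \<delta> \<Longrightarrow> dist (T w) (T w') \<le> \<epsilon>"
  shows "dBL UNIV dist (plug_in_law n T z) (plug_in_law n T z') \<le> \<epsilon> + 2 / \<delta> * mean_dist n z z'"
proof (rule dBL_leI)
  fix f :: "'h \<Rightarrow> real" assume f: "bl_norm UNIV dist f \<le> 1"
  interpret D: prob_space "boot_draws n n"
    by (rule prob_space_boot_draws[OF n])
  note [simp] = integrable_boot_draws[OF n]
  have f_cont: "continuous_on UNIV f"
    by (rule bl_norm_imp_continuous_on[OF f])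
  have pointwise: "\<bar>f (T w) - f (T w')\<bar> \<le> \<epsilon> + 2 / \<delta> * mean_dist n w w'"
    if w: "w \<in> tuples n" "w' \<in> tuples n" for w w'
  proof (cases "mean_dist n w w' < \<delta>")
    case True
    have "\<bar>f (T w) - f (T w')\<bar> \<le> dist (T w) (T w')"
      by (rule bl_norm_imp_Lipschitz[OF f]) auto
    also have "\<dots> \<le> \<epsilon>"
      by (rule unif[OF w True])
    finally show ?thesis
      using \<open>0 < \<delta>\<close> mean_dist_nonneg[of n w w'] by (simp add: add_increasing2)
  next
    case False
    then have "1 \<le> mean_dist n w w' / \<delta>"
      using \<open>0 < \<delta>\<close> by (simp add: le_divide_eq)
    moreover have "\<bar>f (T w)\<bar> \<le> 1" "\<bar>f (T w')\<bar> \<le> 1"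
      using bl_norm_imp_bounded[OF f] by auto
    ultimately show ?thesis
      using \<open>0 \<le> \<epsilon>\<close> by (simp add: abs_le_iff)
  qed
  have "\<bar>(\<integral>x. f x \<partial>plug_in_law n T z) - (\<integral>x. f x \<partial>plug_in_law n T z')\<bar>
      = \<bar>\<integral>J. f (T (reindex n z J)) - f (T (reindex n z' J)) \<partial>boot_draws n n\<bar>"
    using z by (simp add: integral_plug_in_law[OF n _ cont f_cont])
  also have "\<dots> \<le> (\<integral>J. \<bar>f (T (reindex n z J)) - f (T (reindex n z' J))\<bar> \<partial>boot_draws n n)"
    by (rule integral_abs_bound)
  also have "\<dots> \<le> (\<integral>J. \<epsilon> + 2 / \<delta> * mean_dist n (reindex n z J) (reindex n z' J) \<partial>boot_draws n n)"
    by (intro integral_mono integrable_boot_draws[OF n] pointwise reindex_in_tuples z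
        space_boot_draws_imp_Pi)
  also have "\<dots> = \<epsilon> + 2 / \<delta> * (\<integral>J. mean_dist n (reindex n z J) (reindex n z' J) \<partial>boot_draws n n)"
    by (subst Bochner_Integration.integral_add) (auto simp: D.prob_space simp del: times_divide_eq_left)
  also have "(\<integral>J. mean_dist n (reindex n z J) (reindex n z' J) \<partial>boot_draws n n) = mean_dist n z z'"
    by (rule expected_mean_dist_reindex[OF n integral_boot_draws_component[OF n]])
  finally show "\<bar>(\<integral>x. f x \<partial>plug_in_law n T z) - (\<integral>x. f x \<partial>plug_in_law n T z')\<bar>
      \<le> \<epsilon> + 2 / \<delta> * mean_dist n z z'" .
qed

lemma topspace_weak_topology: "topspace weak_topology = prob_measures borel"
proof -
  have "prob_measures borel \<in> {{\<mu> \<in> prob_measures borel. (\<integral>x. f x \<partial>\<mu>) \<in> U} | (f :: 'a \<Rightarrow> real) U.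
        continuous_on UNIV f \<and> bounded (range f) \<and> open U}"
    by (intro CollectI exI[of _ "\<lambda>_. 0"] exI[of _ UNIV]) auto
  then show ?thesis
    unfolding weak_topology_def topology_generated_by_topspace by blast
qed

lemma space_borel_of [simp]: "space (borel_of T) = topspace T"
  unfolding borel_of_def by (rule space_measure_of) (auto dest: openin_subset)

lemma measurable_borel_ofI:
  assumes "f \<in> space M \<rightarrow> topspace T"
    and "\<And>U. openin T U \<Longrightarrow> f -` U \<inter> space M \<in> sets M"
  shows "f \<in> measurable M (borel_of T)"
  unfolding borel_of_def using assms
  by (intro measurable_measure_of) (auto dest: openin_subset)

text \<open>The law of \<open>T\<close> is a mixture, with weights that do not depend on \<open>z\<close>, of finitely many point
  masses at points that depend continuously on \<open>z\<close>.\<close>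

lemma continuous_map_plug_in_law:
  fixes T :: "(nat \<Rightarrow> real ^ 'd) \<Rightarrow> 'h :: topological_space"
  assumes n: "1 \<le> n" and cont: "continuous_on (tuples n) T"
  shows "continuous_map (top_of_set (tuples n)) weak_topology (plug_in_law n T)"
  unfolding weak_topology_def
proof (rule continuous_on_generated_topo)
  have "plug_in_law n T ` tuples n \<subseteq> topspace weak_topology"
    using plug_in_law_in_prob_measures[OF n _ cont] by (auto simp: topspace_weak_topology)
  then show "plug_in_law n T ` topspace (top_of_set (tuples n)) \<subseteq>
      \<Union> {{\<mu> \<in> prob_measures borel. (\<integral>x. f x \<partial>\<mu>) \<in> U} | (f :: 'h \<Rightarrow> real) U.
        continuous_on UNIV f \<and> bounded (range f) \<and> open U}"
    by (simp add: weak_topology_def)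
next
  fix V assume "V \<in> {{\<mu> \<in> prob_measures borel. (\<integral>x. f x \<partial>\<mu>) \<in> U} | (f :: 'h \<Rightarrow> real) U.
        continuous_on UNIV f \<and> bounded (range f) \<and> open U}"
  then obtain f :: "'h \<Rightarrow> real" and U where f: "continuous_on UNIV f" and "open U"
    and V: "V = {\<mu> \<in> prob_measures borel. (\<integral>x. f x \<partial>\<mu>) \<in> U}"
    by blast
  interpret prob_space "boot_draws n n"
    by (rule prob_space_boot_draws[OF n])
  define F where "F z = (\<integral>J. f (T (reindex n z J)) \<partial>boot_draws n n)" for z
  have "F = (\<lambda>z. \<Sum>J\<in>space (boot_draws n n). prob {J} * f (T (reindex n z J)))"
    unfolding F_def
    by (intro ext integral_finite_space_eq_sum finite_space_boot_draws)
       (auto simp: sets_boot_draws space_boot_draws finite_measure_axioms)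
  moreover have "continuous_on (tuples n) (\<lambda>z. f (T (reindex n z J)))"
    if J: "J \<in> space (boot_draws n n)" for J
  proof (rule continuous_on_compose2[OF f])
    show "continuous_on (tuples n) (\<lambda>z. T (reindex n z J))"
      by (rule continuous_on_compose2[OF cont continuous_on_reindex])
         (intro image_subsetI reindex_in_tuples space_boot_draws_imp_Pi J)
  qed simp
  ultimately have "continuous_on (tuples n) F"
    by (auto intro!: continuous_intros)
  then have "openin (top_of_set (tuples n)) (tuples n \<inter> F -` U)"
    using \<open>open U\<close> by (rule continuous_openin_preimage_gen)
  also have "tuples n \<inter> F -` U = plug_in_law n T -` V \<inter> topspace (top_of_set (tuples n))"
    unfolding V F_def using plug_in_law_in_prob_measures[OF n _ cont] integral_plug_in_law[OF n _ cont f]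
    by (auto simp del: PiE_iff)
  finally show "openin (top_of_set (tuples n)) (plug_in_law n T -` V \<inter> topspace (top_of_set (tuples n)))" .
qed

section \<open>The moving block bootstrap as a random reindexing\<close>

lemma nth_concat_equal_lengths:
  assumes "\<And>xs. xs \<in> set xss \<Longrightarrow> length xs = b" "m < length xss * b"
  shows "concat xss ! m = xss ! (m div b) ! (m mod b)"
  using assms
proof (induction xss arbitrary: m)
  case (Cons xs xss)
  have len: "length xs = b"
    using Cons.prems(1) by simp
  show ?case
  proof (cases "m < b")
    case True
    then show ?thesis by (simp add: nth_append len)
  next
    case False
    have "0 < b"
      using Cons.prems(2) by (cases b) auto
    have "concat (xs # xss) ! m = concat xss ! (m - b)"
      using False by (simp add: nth_append len)
    also have "\<dots> = xss ! ((m - b) div b) ! ((m - b) mod b)"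
      using Cons.prems False by (intro Cons.IH) auto
    finally show ?thesis
      using False \<open>0 < b\<close> by (simp add: le_div_geq le_mod_geq)
  qed
qed simp

text \<open>The index of the original observation that the block bootstrap puts at position \<open>t\<close>: within the
  block number \<open>(t - 1) div b + 1\<close> the offset is \<open>(t - 1) mod b\<close>, and the circular extension reduces
  the result modulo \<open>n\<close> to \<open>{1..n}\<close>.\<close>

definition block_index :: "nat \<Rightarrow> nat \<Rightarrow> (nat \<Rightarrow> nat) \<Rightarrow> nat \<Rightarrow> nat" where
  "block_index n b I t = (I ((t - 1) div b + 1) + (t - 1) mod b - 1) mod n + 1"

lemma boot_sample_eq_reindex:
  assumes "1 \<le> b" "n \<le> l * b"
  shows "boot_sample n b l z I = reindex n z (block_index n b I)"
  unfolding boot_sample_def reindex_def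
proof (rule restrict_ext)
  fix t assume t: "t \<in> {1..n}"
  let ?xss = "map (\<lambda>k. block n b z (I k)) [1..<l + 1]"
  have m: "t - 1 < n" "t - 1 < l * b"
    using t assms by auto
  have k: "(t - 1) div b < l"
    using m(2) by (simp add: less_mult_imp_div_less)
  have r: "(t - 1) mod b < b"
    using assms by simp
  have "take n (concat ?xss) ! (t - 1) = concat ?xss ! (t - 1)"
    using m by simp
  also have "\<dots> = ?xss ! ((t - 1) div b) ! ((t - 1) mod b)"
  proof (rule nth_concat_equal_lengths)
    show "length xs = b" if "xs \<in> set ?xss" for xs
      using that by (auto simp: block_def)
    show "t - 1 < length ?xss * b"
      using m(2) by (simp only: length_map length_upt diff_add_inverse2)
  qed
  also have "?xss ! ((t - 1) div b) = block n b z (I ((t - 1) div b + 1))"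
    using k by (simp del: upt_Suc)
  also have "\<dots> ! ((t - 1) mod b) = z (block_index n b I t)"
    using r by (simp add: block_def circular_def block_index_def)
  finally show "take n (concat ?xss) ! (t - 1) = z (block_index n b I t)" .
qed

lemma block_index_in: "1 \<le> n \<Longrightarrow> block_index n b I \<in> {1..n} \<rightarrow> {1..n}"
  by (auto simp: block_index_def Suc_le_eq)

lemma sum_circular_shift:
  fixes h :: "nat \<Rightarrow> real"
  assumes "1 \<le> n"
  shows "(\<Sum>i = 1..n. h ((i + r - 1) mod n + 1)) = (\<Sum>i = 1..n. h i)"
proof (rule sum.reindex_bij_betw)
  let ?s = "\<lambda>i. (i + r - 1) mod n + 1"
  have inj: "i = j" if "i \<in> {1..n}" "j \<in> {1..n}" "?s i = ?s j" "i \<le> j" for i j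
  proof -
    have "n dvd (j + r - 1) - (i + r - 1)"
      using that by (intro mod_eq_dvd_iff_nat[THEN iffD1]) auto
    then have "n dvd j - i"
      using that by simp
    then show ?thesis
      using that by (auto dest: dvd_imp_le)
  qed
  have "inj_on ?s {1..n}"
    using inj by (intro inj_onI) (metis nat_le_linear)
  moreover have "?s ` {1..n} \<subseteq> {1..n}"
    using assms by (auto simp: Suc_le_eq)
  ultimately show "bij_betw ?s {1..n} {1..n}"
    by (simp add: bij_betw_def endo_inj_surj)
qed

text \<open>Each position holds the uniform starting point of its block, shifted along the circle by a fixed
  offset, and a circular shift preserves the uniform distribution.\<close>

lemma integral_block_index:
  fixes h :: "nat \<Rightarrow> real"
  assumes "1 \<le> n" "n \<le> l * b" "t \<in> {1..n}"
  shows "(\<integral>I. h (block_index n b I t) \<partial>boot_draws n l) = (\<Sum>i = 1..n. h i) / real n"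
proof -
  have "t - 1 < l * b"
    using assms by auto
  then have "(t - 1) div b + 1 \<in> {1..l}"
    by (simp add: less_mult_imp_div_less Suc_le_eq)
  then have "(\<integral>I. h (block_index n b I t) \<partial>boot_draws n l)
      = (\<Sum>i = 1..n. h ((i + (t - 1) mod b - 1) mod n + 1)) / real n"
    unfolding block_index_def
    by (rule integral_boot_draws_component[OF assms(1),
        where h = "\<lambda>i. h ((i + (t - 1) mod b - 1) mod n + 1)"])
  then show ?thesis
    by (simp only: sum_circular_shift[OF assms(1)])
qed

section \<open>Stability of the law of the bootstrap approximation\<close>

lemma fin_law_prob:
  assumes "P \<in> prob_measures seqM"
  shows "prob_space (fin_law P n)" "sets (fin_law P n) = sets (tupleM n)"
    "space (fin_law P n) = tuples n"
proof -
  have sets: "sets P = sets seqM" and "prob_space P"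
    using assms by (auto simp: prob_measures_def)
  interpret prob_space P by fact
  have "(\<lambda>\<omega>. restrict \<omega> {1..n}) \<in> measurable P (tupleM n)"
    unfolding measurable_cong_sets[OF sets refl] by (intro measurable_restrict_subset) auto
  then show "prob_space (fin_law P n)"
    unfolding fin_law_def by (rule prob_space_distr)
  show "sets (fin_law P n) = sets (tupleM n)"
    by (simp add: fin_law_def)
  show "space (fin_law P n) = tuples n"
    unfolding fin_law_def space_distr by (rule space_tupleM)
qed

text \<open>For each of the finitely many index draws the map is continuous in the data.  Measurability is
  needed because \<open>distr\<close> along a map that is not measurable need not be the image measure.\<close>

lemma measurable_boot_map:
  fixes T :: "(nat \<Rightarrow> real ^ 'd) \<Rightarrow> 'h :: topological_space"
  assumes n: "1 \<le> n" and cont: "continuous_on (tuples n) T"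
  shows "(\<lambda>(z, I). plug_in_law n T (reindex n z (block_index n b I)))
    \<in> measurable (tupleM n \<Otimes>\<^sub>M boot_draws n l) (borel_of weak_topology)"
proof -
  let ?F = "\<lambda>I z. plug_in_law n T (reindex n z (block_index n b I))"
  have fixed: "?F I \<in> measurable (tupleM n) (borel_of weak_topology)" for I
  proof (rule measurable_borel_ofI)
    have "continuous_map (top_of_set (tuples n)) (top_of_set (tuples n))
        (\<lambda>z :: nat \<Rightarrow> real ^ 'd. reindex n z (block_index n b I))"
      unfolding continuous_map_in_subtopology continuous_map_iff_continuous topspace_euclidean_subtopology
    proof
      show "(\<lambda>z. reindex n z (block_index n b I)) \<in> tuples n \<rightarrow> (tuples n :: (nat \<Rightarrow> real ^ 'd) set)"
        by (rule funcsetI) (rule reindex_in_tuples[OF _ block_index_in[OF n]])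
    qed (rule continuous_on_reindex)
    from continuous_map_compose[OF this continuous_map_plug_in_law[OF n cont]]
    have F: "continuous_map (top_of_set (tuples n)) weak_topology (?F I)"
      by (simp add: o_def)
    show "?F I \<in> space (tupleM n) \<rightarrow> topspace weak_topology"
      using F unfolding space_tupleM continuous_map_def by simp
    fix U :: "'h measure set" assume "openin weak_topology U"
    from openin_continuous_map_preimage[OF F this]
    have "?F I -` U \<inter> tuples n \<in> sets (tupleM n)"
      by (intro openin_tuples_imp_sets) (simp add: vimage_def Collect_conj_eq Int_commute)
    then show "?F I -` U \<inter> space (tupleM n) \<in> sets (tupleM n)"
      by (simp only: space_tupleM)
  qed
  have "(\<lambda>p. ?F (snd p) (fst p)) \<in> measurable (tupleM n \<Otimes>\<^sub>M boot_draws n l) (borel_of weak_topology)"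
  proof (rule measurable_compose_countable'[where f = "\<lambda>I p. ?F I (fst p)" and g = snd
        and I = "space (boot_draws n l)"])
    show "(\<lambda>p. ?F I (fst p)) \<in> measurable (tupleM n \<Otimes>\<^sub>M boot_draws n l) (borel_of weak_topology)" for I
      by (rule measurable_compose[OF measurable_fst fixed])
    have "sets (boot_draws n l) = sets (count_space (space (boot_draws n l)))"
      by (simp add: sets_boot_draws space_boot_draws)
    from measurable_cong_sets[OF refl this]
    show "snd \<in> measurable (tupleM n \<Otimes>\<^sub>M boot_draws n l) (count_space (space (boot_draws n l)))"
      using measurable_snd by blast
    show "countable (space (boot_draws n l))"
      by (intro countable_finite finite_space_boot_draws)
  qed
  then show ?thesis
    by (simp only: case_prod_beta')
qed

text \<open>By Fubini, integrating a test function against the law of the bootstrap approximation is the same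
  as integrating its bootstrap average \<open>g\<close> against the law of the data.\<close>

lemma integral_boot_law:
  fixes T :: "(nat \<Rightarrow> real ^ 'd) \<Rightarrow> 'h :: topological_space" and G :: "'h measure \<Rightarrow> real"
  assumes P: "P \<in> prob_measures seqM" and n: "1 \<le> n" and cont: "continuous_on (tuples n) T"
    and bl: "1 \<le> b" "n \<le> l * b"
    and G: "G \<in> borel_measurable (borel_of weak_topology)"
    and G_bound: "\<And>\<mu>. \<mu> \<in> prob_measures borel \<Longrightarrow> \<bar>G \<mu>\<bar> \<le> 1"
  defines "g \<equiv> \<lambda>z. \<integral>I. G (plug_in_law n T (reindex n z (block_index n b I))) \<partial>boot_draws n l"
  shows "(\<integral>\<mu>. G \<mu> \<partial>boot_law P n b l T) = (\<integral>z. g z \<partial>fin_law P n)"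
    and "integrable (fin_law P n) g"
proof -
  let ?F = "\<lambda>(z, I). plug_in_law n T (reindex n z (block_index n b I))"
  interpret L: prob_space "fin_law P n"
    by (rule fin_law_prob[OF P])
  interpret D: prob_space "boot_draws n l"
    by (rule prob_space_boot_draws[OF n])
  interpret LD: pair_prob_space "fin_law P n" "boot_draws n l" ..
  have F: "?F \<in> measurable (fin_law P n \<Otimes>\<^sub>M boot_draws n l) (borel_of weak_topology)"
    using measurable_boot_map[OF n cont]
    by (subst measurable_cong_sets[OF sets_pair_measure_cong[OF fin_law_prob(2)[OF P] refl] refl])
  have GF: "(\<lambda>p. G (?F p)) \<in> borel_measurable (fin_law P n \<Otimes>\<^sub>M boot_draws n l)"
    by (rule measurable_compose[OF F G])
  have int: "integrable (fin_law P n \<Otimes>\<^sub>M boot_draws n l) (\<lambda>p. G (?F p))"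
  proof (rule LD.integrable_const_bound[where B = 1, OF AE_I2 GF])
    fix p assume "p \<in> space (fin_law P n \<Otimes>\<^sub>M boot_draws n l)"
    then have "?F p \<in> space (borel_of weak_topology)"
      by (rule measurable_space[OF F])
    then show "norm (G (?F p)) \<le> 1"
      unfolding space_borel_of topspace_weak_topology real_norm_def by (rule G_bound)
  qed
  have "(\<integral>\<mu>. G \<mu> \<partial>boot_law P n b l T)
      = (\<integral>\<mu>. G \<mu> \<partial>distr (fin_law P n \<Otimes>\<^sub>M boot_draws n l) (borel_of weak_topology) ?F)"
    by (simp only: boot_law_def plug_in_law_def boot_sample_eq_reindex[OF bl])
  also have "\<dots> = (\<integral>p. G (?F p) \<partial>(fin_law P n \<Otimes>\<^sub>M boot_draws n l))"
    by (rule integral_distr[OF F G])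
  also have "\<dots> = (\<integral>z. \<integral>I. G (?F (z, I)) \<partial>boot_draws n l \<partial>fin_law P n)"
    by (rule LD.integral_fst'[OF int, symmetric])
  finally show "(\<integral>\<mu>. G \<mu> \<partial>boot_law P n b l T) = (\<integral>z. g z \<partial>fin_law P n)"
    by (simp add: g_def)
  show "integrable (fin_law P n) g"
    using LD.integrable_fst'[OF int] by (simp add: g_def)
qed

lemma dBL_test_function_Lipschitz:
  fixes G :: "'h :: metric_space measure \<Rightarrow> real"
  assumes G: "bl_norm (prob_measures borel) (dBL UNIV dist) G \<le> 1"
    and \<mu>\<nu>: "\<mu> \<in> prob_measures borel" "\<nu> \<in> prob_measures borel"
  shows "\<bar>G \<mu> - G \<nu>\<bar> \<le> dBL UNIV dist \<mu> \<nu>"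
proof -
  have "space \<mu> = UNIV" "space \<nu> = UNIV" "prob_space \<mu>" "prob_space \<nu>"
    using \<mu>\<nu> sets_eq_imp_space_eq[of \<mu> borel] sets_eq_imp_space_eq[of \<nu> borel]
    by (auto simp: prob_measures_def)
  then have nonneg: "0 \<le> dBL UNIV dist \<mu> \<nu>"
    by (intro dBL_nonneg)
  show ?thesis
  proof (cases "\<mu> = \<nu>")
    case False
    then have "0 < dBL UNIV dist \<mu> \<nu>"
      using nonneg dBL_eq_0_imp_eq[OF \<mu>\<nu>] by fastforce
    then show ?thesis
      using bl_norm_imp_quotient_le[OF G \<mu>\<nu> False] by (simp add: divide_le_eq)
  qed (use nonneg in simp)
qed

text \<open>For a test function \<open>G\<close> on the space of measures let \<open>g z\<close> be the average of \<open>G\<close> over the bootstrap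
  approximations of the data \<open>z\<close>.  Using the same blocks for two data sets, the preceding estimates
  bound \<open>g z - g z'\<close> by \<open>\<epsilon> + 2 / \<delta> * mean_dist n z z'\<close>.  So \<open>g\<close> is within \<open>\<epsilon>\<close> of a function \<open>h\<close>
  that is Lipschitz for \<open>mean_dist\<close>, hence for \<open>tuple_dist\<close>, and bounded by \<open>1 + \<epsilon>\<close>; the
  bounded Lipschitz distance of the two data laws controls the integrals of \<open>h\<close>, and passing from
  \<open>g\<close> to \<open>h\<close> costs \<open>\<epsilon>\<close> for each of the two laws.\<close>

lemma dBL_boot_law_le:
  fixes T :: "(nat \<Rightarrow> real ^ 'd) \<Rightarrow> 'h :: metric_space"
  assumes P: "P \<in> prob_measures seqM" and Q: "Q \<in> prob_measures seqM"
    and n: "1 \<le> n" and cont: "continuous_on (tuples n) T"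
    and bl: "1 \<le> b" "n \<le> l * b"
    and \<delta>: "0 < \<delta>" and \<epsilon>: "0 < \<epsilon>"
    and unif: "\<And>w w'. w \<in> tuples n \<Longrightarrow> w' \<in> tuples n \<Longrightarrow> mean_dist n w w' < \<delta> \<Longrightarrow> dist (T w) (T w') \<le> \<epsilon>"
  shows "dBL (prob_measures borel) (dBL UNIV dist) (boot_law P n b l T) (boot_law Q n b l T)
    \<le> 2 * \<epsilon> + (2 / \<delta> * (1 + diameter (unit_cube :: (real ^ 'd) set)) + (1 + \<epsilon>))
        * dBL (tuples n) (tuple_dist n) (fin_law P n) (fin_law Q n)"
    (is "_ \<le> 2 * \<epsilon> + (2 / \<delta> * ?K + (1 + \<epsilon>)) * ?d")
proof (rule dBL_leI)
  fix G :: "'h measure \<Rightarrow> real"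
  assume G: "bl_norm (prob_measures borel) (dBL UNIV dist) G \<le> 1"
  have K: "0 \<le> ?K"
    using diameter_ge_0[OF bounded_unit_cube[where 'd = 'd]] by simp
  have d: "0 \<le> ?d"
    by (intro dBL_nonneg fin_law_prob P Q)
  have rhs_nonneg: "0 \<le> 2 * \<epsilon> + (2 / \<delta> * ?K + (1 + \<epsilon>)) * ?d"
    using \<delta> \<epsilon> K d by simp
  show "\<bar>(\<integral>\<mu>. G \<mu> \<partial>boot_law P n b l T) - (\<integral>\<mu>. G \<mu> \<partial>boot_law Q n b l T)\<bar>
      \<le> 2 * \<epsilon> + (2 / \<delta> * ?K + (1 + \<epsilon>)) * ?d"
  proof (cases "G \<in> borel_measurable (borel_of weak_topology)")
    case False
    \<comment> \<open>Both integrals are then 0 by convention.\<close>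
    have "\<not> integrable (boot_law R n b l T) G" for R
    proof
      assume "integrable (boot_law R n b l T) G"
      then have "G \<in> borel_measurable (boot_law R n b l T)"
        by (rule borel_measurable_integrable)
      then have "G \<in> borel_measurable (borel_of weak_topology)"
        unfolding boot_law_def measurable_distr_eq1 .
      with False show False ..
    qed
    then show ?thesis
      using rhs_nonneg by (simp add: not_integrable_integral_eq)
  next
    case True
    interpret D: prob_space "boot_draws n l"
      by (rule prob_space_boot_draws[OF n])
    interpret LP: prob_space "fin_law P n"
      by (rule fin_law_prob[OF P])
    interpret LQ: prob_space "fin_law Q n"
      by (rule fin_law_prob[OF Q])
    note G_bound = bl_norm_imp_bounded[OF G]
    let ?z = "\<lambda>z I. reindex n z (block_index n b I)"
    have in_tuples: "?z z I \<in> tuples n" if "z \<in> tuples n" for z :: "nat \<Rightarrow> real ^ 'd" and I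
      by (intro reindex_in_tuples that block_index_in n)
    define g where "g z = (\<integral>I. G (plug_in_law n T (?z z I)) \<partial>boot_draws n l)" for z
    have g_bound: "\<bar>g z\<bar> \<le> 1" if "z \<in> tuples n" for z
      unfolding g_def
      by (intro D.abs_integral_le_bound G_bound plug_in_law_in_prob_measures n cont in_tuples that) simp
    have g_almost: "g z - g z' \<le> \<epsilon> + 2 / \<delta> * mean_dist n z z'"
      if z: "z \<in> tuples n" "z' \<in> tuples n" for z z'
    proof -
      note int = integrable_boot_draws[OF n]
      have "g z - g z' = (\<integral>I. G (plug_in_law n T (?z z I)) - G (plug_in_law n T (?z z' I)) \<partial>boot_draws n l)"
        unfolding g_def by (rule Bochner_Integration.integral_diff[OF int int, symmetric])
      also have "\<dots> \<le> (\<integral>I. \<epsilon> + 2 / \<delta> * mean_dist n (?z z I) (?z z' I) \<partial>boot_draws n l)"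
      proof (rule integral_mono[OF int int])
        fix I
        have "G (plug_in_law n T (?z z I)) - G (plug_in_law n T (?z z' I))
            \<le> dBL UNIV dist (plug_in_law n T (?z z I)) (plug_in_law n T (?z z' I))"
          by (rule abs_le_D1[OF dBL_test_function_Lipschitz[OF G]])
             (intro plug_in_law_in_prob_measures n cont in_tuples z)+
        also have "\<dots> \<le> \<epsilon> + 2 / \<delta> * mean_dist n (?z z I) (?z z' I)"
          using \<epsilon> by (intro dBL_plug_in_law_le n in_tuples z cont \<delta> unif) auto
        finally show "G (plug_in_law n T (?z z I)) - G (plug_in_law n T (?z z' I))
            \<le> \<epsilon> + 2 / \<delta> * mean_dist n (?z z I) (?z z' I)" .
      qed
      also have "\<dots> = \<epsilon> + 2 / \<delta> * (\<integral>I. mean_dist n (?z z I) (?z z' I) \<partial>boot_draws n l)"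
        by (subst Bochner_Integration.integral_add[OF int int]) (simp add: D.prob_space)
      also have "(\<integral>I. mean_dist n (?z z I) (?z z' I) \<partial>boot_draws n l) = mean_dist n z z'"
        by (rule expected_mean_dist_reindex[OF n integral_block_index[OF n bl(2)]])
      finally show ?thesis .
    qed
    have "0 \<le> 2 / \<delta>"
      using \<delta> by simp
    then obtain h where h_Lip: "\<And>z z'. z \<in> tuples n \<Longrightarrow> z' \<in> tuples n \<Longrightarrow> \<bar>h z - h z'\<bar> \<le> 2 / \<delta> * mean_dist n z z'"
      and h_close: "\<And>z. z \<in> tuples n \<Longrightarrow> g z - \<epsilon> \<le> h z \<and> h z \<le> g z"
      using almost_Lipschitz_approx[where X = "tuples n" and g = g and \<rho> = "mean_dist n",
          OF mean_dist_self mean_dist_commute mean_dist_triangle mean_dist_nonneg g_bound g_almost]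
      by blast
    have h_bound: "\<bar>h z\<bar> \<le> 1 + \<epsilon>" if "z \<in> tuples n" for z
      using g_bound[OF that] h_close[OF that] by linarith
    have h_meas: "h \<in> borel_measurable (tupleM n)"
      by (rule continuous_on_tuples_imp_measurable[OF mean_dist_Lipschitz_imp_continuous_on[OF h_Lip]])
    have "\<bar>h z - h z'\<bar> \<le> 2 / \<delta> * ?K * tuple_dist n z z'" if "z \<in> tuples n" "z' \<in> tuples n" for z z'
    proof -
      have "\<bar>h z - h z'\<bar> \<le> 2 / \<delta> * mean_dist n z z'"
        by (rule h_Lip[OF that])
      also have "\<dots> \<le> 2 / \<delta> * (?K * tuple_dist n z z')"
        using \<delta> by (intro mult_left_mono mean_dist_le_tuple_dist n that) simp
      finally show ?thesis by (simp only: mult.assoc)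
    qed
    then have h_diff: "\<bar>(\<integral>z. h z \<partial>fin_law P n) - (\<integral>z. h z \<partial>fin_law Q n)\<bar> \<le> (2 / \<delta> * ?K + (1 + \<epsilon>)) * ?d"
      using \<delta> \<epsilon> K
      by (intro abs_integral_diff_le_scaled_dBL fin_law_prob P Q h_bound tuple_dist_nonneg) auto
    have close: "\<bar>(\<integral>z. g z \<partial>fin_law R n) - (\<integral>z. h z \<partial>fin_law R n)\<bar> \<le> \<epsilon>"
      if R: "R \<in> prob_measures seqM" for R
    proof -
      interpret LR: prob_space "fin_law R n"
        by (rule fin_law_prob[OF R])
      have g_int: "integrable (fin_law R n) g"
        unfolding g_def by (rule integral_boot_law(2)[OF R n cont bl True G_bound])
      have h_int: "integrable (fin_law R n) h"
      proof (rule LR.integrable_const_bound[where B = "1 + \<epsilon>"])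
        show "AE z in fin_law R n. norm (h z) \<le> 1 + \<epsilon>"
          unfolding real_norm_def by (intro AE_I2 h_bound) (simp only: fin_law_prob(3)[OF R])
        show "h \<in> borel_measurable (fin_law R n)"
          using h_meas by (simp only: measurable_cong_sets[OF fin_law_prob(2)[OF R] refl])
      qed
      have "\<bar>\<integral>z. g z - h z \<partial>fin_law R n\<bar> \<le> \<epsilon>"
      proof (rule LR.abs_integral_le_bound)
        fix z assume "z \<in> space (fin_law R n)"
        then have "z \<in> tuples n"
          by (simp only: fin_law_prob(3)[OF R])
        from h_close[OF this] show "\<bar>g z - h z\<bar> \<le> \<epsilon>"
          by linarith
      qed (use \<epsilon> in simp)
      then show ?thesis
        by (simp add: Bochner_Integration.integral_diff[OF g_int h_int])
    qed
    have "(\<integral>\<mu>. G \<mu> \<partial>boot_law R n b l T) = (\<integral>z. g z \<partial>fin_law R n)"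
      if "R \<in> prob_measures seqM" for R
      unfolding g_def by (rule integral_boot_law(1)[OF that n cont bl True G_bound])
    then have "(\<integral>\<mu>. G \<mu> \<partial>boot_law P n b l T) = (\<integral>z. g z \<partial>fin_law P n)"
      "(\<integral>\<mu>. G \<mu> \<partial>boot_law Q n b l T) = (\<integral>z. g z \<partial>fin_law Q n)"
      using P Q by blast+
    then show ?thesis
      using close[OF P] close[OF Q] h_diff by linarith
  qed
qed

lemma continuous_map_tuples_imp_continuous_on:
  fixes T :: "(nat \<Rightarrow> real ^ 'd) \<Rightarrow> 'h :: topological_space"
  assumes "continuous_map (product_topology (\<lambda>_. top_of_set unit_cube) {1..n}) euclidean T"
  shows "continuous_on (tuples n) T"
proof -
  have "continuous_map (top_of_set (tuples n)) (product_topology (\<lambda>_. top_of_set unit_cube) {1..n})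
      (\<lambda>z :: nat \<Rightarrow> real ^ 'd. z)"
    unfolding continuous_map_componentwise continuous_map_in_subtopology continuous_map_iff_continuous
    by (auto simp: PiE_def intro: continuous_on_product_then_coordinatewise[OF continuous_on_id])
  from continuous_map_compose[OF this assms] show ?thesis
    by (simp add: o_def)
qed

theorem theorem2p7:
  fixes P :: "(nat \<Rightarrow> real ^ 'd) measure"
    and Sn :: "nat \<Rightarrow> (nat \<Rightarrow> real ^ 'd) \<Rightarrow> 'h :: {metric_space, second_countable_topology}"
    and S :: "(real ^ 'd) measure \<Rightarrow> 'h"
    and b l :: "nat \<Rightarrow> nat"
    and a :: real
  assumes "CARD('d) > 1"
    and "P \<in> mixing_class"
    and "continuous_marginals P"
    and "completely_metrizable_space (euclidean :: 'h topology)"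
    and "\<And>n. n \<ge> 1 \<Longrightarrow>
           continuous_map (product_topology (\<lambda>_. top_of_set unit_cube) {1..n}) euclidean (Sn n)"
    and "\<And>n z. n \<ge> 1 \<Longrightarrow> z \<in> tuples n \<Longrightarrow> Sn n z = S (empirical n z)"
    and "\<forall>\<epsilon>>0. \<exists>\<delta>>0. \<forall>\<mu>\<in>prob_measures cubeM. \<forall>\<nu>\<in>prob_measures cubeM.
           dBL unit_cube dist \<mu> \<nu> < \<delta> \<longrightarrow> dist (S \<mu>) (S \<nu>) < \<epsilon>"
    and "\<And>n. n \<ge> 2 \<Longrightarrow> 1 \<le> b n \<and> b n < n"
    and "\<And>n. n \<ge> 2 \<Longrightarrow> l n = nat \<lceil>real n / real (b n)\<rceil>"
    and "a > 0"
    and "(\<lambda>n. real (b n)) \<in> O(\<lambda>n. real n powr (1 / 2 - a))"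
  shows "\<forall>\<epsilon>>0. \<exists>\<delta>>0. \<exists>n0. \<forall>n\<ge>n0. \<forall>Q\<in>mixing_class.
           dBL (tuples n) (tuple_dist n) (fin_law P n) (fin_law Q n) < \<delta> \<longrightarrow>
           dBL (prob_measures borel) (dBL UNIV dist)
             (boot_law P n (b n) (l n) (Sn n)) (boot_law Q n (b n) (l n) (Sn n)) < \<epsilon>"
proof (intro allI impI)
  fix \<epsilon> :: real assume "0 < \<epsilon>"
  \<comment> \<open>The final bound is at most \<open>2 * \<epsilon>' + \<epsilon>'\<close>.\<close>
  define \<epsilon>' where "\<epsilon>' = \<epsilon> / 4"
  have \<epsilon>': "0 < \<epsilon>'"
    using \<open>0 < \<epsilon>\<close> by (simp add: \<epsilon>'_def)
  obtain \<eta> where \<eta>: "0 < \<eta>"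
    and S: "\<And>\<mu> \<nu>. \<mu> \<in> prob_measures cubeM \<Longrightarrow> \<nu> \<in> prob_measures cubeM \<Longrightarrow>
      dBL unit_cube dist \<mu> \<nu> < \<eta> \<Longrightarrow> dist (S \<mu>) (S \<nu>) < \<epsilon>'"
    using assms(7) \<epsilon>' by meson
  define C where "C = 2 / \<eta> * (1 + diameter (unit_cube :: (real ^ 'd) set)) + (1 + \<epsilon>')"
  have C: "0 < C"
    unfolding C_def using \<eta> \<epsilon>' diameter_ge_0[OF bounded_unit_cube[where 'd = 'd]]
    by (intro add_nonneg_pos mult_nonneg_nonneg) auto
  show "\<exists>\<delta>>0. \<exists>n0. \<forall>n\<ge>n0. \<forall>Q\<in>mixing_class.
           dBL (tuples n) (tuple_dist n) (fin_law P n) (fin_law Q n) < \<delta> \<longrightarrow>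
           dBL (prob_measures borel) (dBL UNIV dist)
             (boot_law P n (b n) (l n) (Sn n)) (boot_law Q n (b n) (l n) (Sn n)) < \<epsilon>"
  proof (intro exI[of _ "\<epsilon>' / C"] exI[of _ 2] conjI allI impI ballI)
    show "0 < \<epsilon>' / C"
      using \<epsilon>' C by simp
    fix n and Q :: "(nat \<Rightarrow> real ^ 'd) measure"
    assume "2 \<le> n" "Q \<in> mixing_class"
      and close: "dBL (tuples n) (tuple_dist n) (fin_law P n) (fin_law Q n) < \<epsilon>' / C"
    have n: "1 \<le> n" and PQ: "P \<in> prob_measures seqM" "Q \<in> prob_measures seqM"
      using \<open>2 \<le> n\<close> \<open>Q \<in> mixing_class\<close> assms(2) by (auto simp: mixing_class_def)
    have b: "1 \<le> b n"
      using assms(8)[OF \<open>2 \<le> n\<close>] by simp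
    have "real n / real (b n) \<le> real (l n)"
      unfolding assms(9)[OF \<open>2 \<le> n\<close>] by (rule real_nat_ceiling_ge)
    then have "real n \<le> real (l n * b n)"
      using b by (simp add: divide_le_eq)
    then have bl: "n \<le> l n * b n"
      by (simp only: of_nat_le_iff)
    have unif: "dist (Sn n w) (Sn n w') \<le> \<epsilon>'"
      if w: "w \<in> tuples n" "w' \<in> tuples n" and "mean_dist n w w' < \<eta>" for w w'
    proof -
      have "dBL unit_cube dist (empirical n w) (empirical n w') < \<eta>"
        using dBL_empirical_le_mean_dist[OF n w] that(3) by (rule le_less_trans)
      then have "dist (S (empirical n w)) (S (empirical n w')) < \<epsilon>'"
        by (intro S empirical_in_prob_measures n w)
      then show ?thesis
        using assms(6)[OF n w(1)] assms(6)[OF n w(2)] by simp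
    qed
    have "dBL (prob_measures borel) (dBL UNIV dist)
        (boot_law P n (b n) (l n) (Sn n)) (boot_law Q n (b n) (l n) (Sn n))
      \<le> 2 * \<epsilon>' + C * dBL (tuples n) (tuple_dist n) (fin_law P n) (fin_law Q n)"
      unfolding C_def
      by (rule dBL_boot_law_le[OF PQ n continuous_map_tuples_imp_continuous_on[OF assms(5)[OF n]]
          b bl \<eta> \<epsilon>' unif])
    also have "\<dots> < 2 * \<epsilon>' + C * (\<epsilon>' / C)"
      using close C by (intro add_strict_left_mono mult_strict_left_mono)
    also have "\<dots> < \<epsilon>"
      using C \<open>0 < \<epsilon>\<close> by (simp add: \<epsilon>'_def)
    finally show "dBL (prob_measures borel) (dBL UNIV dist)
        (boot_law P n (b n) (l n) (Sn n)) (boot_law Q n (b n) (l n) (Sn n)) < \<epsilon>" .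
  qed
qed

end
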